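(* Fix an integer $n\ge 2$ and let $$\mathcal{S}_n=\Bigl\{\bigl(\operatorname{reg}(R/J(G)),\ \deg h_{R/J(G)}(t)\bigr) : G\text{ is a connected split graph on }n\text{ vertices}\Bigr\}.$$ Then $$\mathcal{S}_n=\{(q,q) : q\in\mathbb{Z},\ q_{\min}(n)\le q\le n-2\},\qquad\text{where}\qquad q_{\min}(n)=\min_{1\le c\le n-1}\Bigl(c+\Bigl\lceil\frac{n}{c}\Bigr\rceil-3\Bigr),$$ the minimum being over integers $c$.
   Context: $\Bbbk$ is a field and $R=\Bbbk[x_v : v\in V(G)]$ with the standard grading. The cover ideal is $J(G)=\bigl(\prod_{v\in W}x_v : W \text{ a minimal vertex cover of } G\bigr)=\bigcap_{\{u,v\}\in E(G)}(x_u,x_v)$. $\operatorname{reg}$ is Castelnuovo–Mumford regularity: $\operatorname{reg}(R/J)=\max\{j-i:\beta_{i,j}(R/J)\ne0\}$. For a standard graded $\Bbbk$-algebra $A$ with Hilbert series $H_A(t)$, the $h$-polynomial $h_A(t)\in\mathbb{Z}[t]$ is the unique polynomial with $H_A(t)=h_A(t)/(1-t)^{\dim A}$. A split graph is a graph whose vertex set admits a partition $C\sqcup I$ with $C$ inducing a clique and $I$ inducing an independent set. *)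

theory Defs
  imports
    "HOL-Library.Poly_Mapping"
    "HOL-Computational_Algebra.Polynomial_FPS"
    "Jordan_Normal_Form.Matrix_Kernel"
begin

section \<open>Graphs on the vertex set \<^term>\<open>UNIV :: 'v set\<close>\<close>

definition simple_graph :: "'v set set \<Rightarrow> bool" where
  "simple_graph E \<longleftrightarrow> (\<forall>e\<in>E. card e = 2)"

definition graph_connected :: "'v set set \<Rightarrow> bool" where
  "graph_connected E \<longleftrightarrow> (\<forall>u v. (u, v) \<in> {(a, b). {a, b} \<in> E}\<^sup>*)"

definition split_graph :: "'v set set \<Rightarrow> bool" where
  "split_graph E \<longleftrightarrow>
     (\<exists>C I. C \<union> I = UNIV \<and> C \<inter> I = {} \<and>
        (\<forall>u\<in>C. \<forall>v\<in>C. u \<noteq> v \<longrightarrow> {u, v} \<in> E) \<and>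
        (\<forall>u\<in>I. \<forall>v\<in>I. {u, v} \<notin> E))"

definition vertex_cover :: "'v set set \<Rightarrow> 'v set \<Rightarrow> bool" where
  "vertex_cover E W \<longleftrightarrow> (\<forall>e\<in>E. e \<inter> W \<noteq> {})"

definition minimal_vertex_cover :: "'v set set \<Rightarrow> 'v set \<Rightarrow> bool" where
  "minimal_vertex_cover E W \<longleftrightarrow>
     vertex_cover E W \<and> (\<forall>W'. W' \<subset> W \<longrightarrow> \<not> vertex_cover E W')"


section \<open>The polynomial ring and its ideals\<close>

text \<open>The polynomial ring over \<open>'k\<close> with one variable for each element of the finite type \<open>'v\<close>;
  its monomials are the exponent vectors in \<open>'v \<Rightarrow>\<^sub>0 nat\<close>.\<close>

type_synonym ('v, 'k) mpoly = "('v \<Rightarrow>\<^sub>0 nat) \<Rightarrow>\<^sub>0 'k"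

definition var :: "'v \<Rightarrow> ('v, 'k::field) mpoly" where
  "var v = Poly_Mapping.single (Poly_Mapping.single v 1) 1"

definition mon_degree :: "('v::finite \<Rightarrow>\<^sub>0 nat) \<Rightarrow> nat" where
  "mon_degree m = (\<Sum>v\<in>UNIV. Poly_Mapping.lookup m v)"

text \<open>The zero polynomial is homogeneous of every degree, and the only one that is homogeneous of
  negative degree.\<close>

definition homogeneous :: "int \<Rightarrow> ('v::finite, 'k::field) mpoly \<Rightarrow> bool" where
  "homogeneous e p \<longleftrightarrow> (\<forall>m\<in>Poly_Mapping.keys p. int (mon_degree m) = e)"

abbreviation ideal_gen :: "('v, 'k::field) mpoly set \<Rightarrow> ('v, 'k) mpoly set" where
  "ideal_gen \<equiv> Modules.module.span (*)"

definition prime_ideal :: "('v, 'k::field) mpoly set \<Rightarrow> bool" where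
  "prime_ideal P \<longleftrightarrow>
     Modules.module.subspace (*) P \<and> P \<noteq> UNIV \<and> (\<forall>a b. a * b \<in> P \<longrightarrow> a \<in> P \<or> b \<in> P)"

definition cover_ideal :: "'v::finite set set \<Rightarrow> ('v, 'k::field) mpoly set" where
  "cover_ideal E = ideal_gen {\<Prod>v\<in>W. var v | W. minimal_vertex_cover E W}"


section \<open>Castelnuovo-Mumford regularity of a quotient ring\<close>

text \<open>A graded free resolution of \<open>R/I\<close> by finitely generated free modules,
  where \<open>R\<close> is the polynomial ring:
    \<open>\<cdots> \<rightarrow> F 2 \<rightarrow> F 1 \<rightarrow> F 0 \<rightarrow> R/I \<rightarrow> 0\<close>.
  The module \<open>F i\<close> is the direct sum of the twists \<open>R(-j)\<close> for \<open>j\<close> in the list \<open>s i\<close>, and the map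
  \<open>F (i+1) \<rightarrow> F i\<close> is given by the matrix \<open>D (i+1)\<close>. The augmentation \<open>F 0 \<rightarrow> R/I\<close> is the one-row
  matrix \<open>D 0\<close> followed by the projection \<open>R \<rightarrow> R/I\<close>; a homogeneous map to \<open>R/I\<close> always lifts
  to such a matrix.\<close>

definition graded_free_resolution ::
  "('v::finite, 'k::field) mpoly set \<Rightarrow> (nat \<Rightarrow> int list) \<Rightarrow> (nat \<Rightarrow> ('v, 'k) mpoly mat) \<Rightarrow> bool"
where
  "graded_free_resolution I s D \<longleftrightarrow>
     D 0 \<in> carrier_mat 1 (length (s 0)) \<and>
     (\<forall>c<length (s 0). homogeneous (s 0 ! c) (D 0 $$ (0, c))) \<and>
     (\<forall>i. D (Suc i) \<in> carrier_mat (length (s i)) (length (s (Suc i)))) \<and>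
     (\<forall>i. \<forall>r<length (s i). \<forall>c<length (s (Suc i)).
        homogeneous (s (Suc i) ! c - s i ! r) (D (Suc i) $$ (r, c))) \<and>
     (\<forall>p. \<exists>w\<in>carrier_vec (length (s 0)). p - (D 0 *\<^sub>v w) $ 0 \<in> I) \<and>
     {w \<in> carrier_vec (length (s 0)). (D 0 *\<^sub>v w) $ 0 \<in> I}
       = (*\<^sub>v) (D 1) ` carrier_vec (length (s 1)) \<and>
     (\<forall>i. mat_kernel (D (Suc i))
       = (*\<^sub>v) (D (Suc (Suc i))) ` carrier_vec (length (s (Suc (Suc i)))))"

text \<open>Minimality: the image of each \<open>F (i+1) \<rightarrow> F i\<close> lies in the multiple of \<open>F i\<close> by the ideal
  generated by the variables, that is, all matrix entries have constant coefficient zero.\<close>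

definition minimal_free_resolution ::
  "('v::finite, 'k::field) mpoly set \<Rightarrow> (nat \<Rightarrow> int list) \<Rightarrow> (nat \<Rightarrow> ('v, 'k) mpoly mat) \<Rightarrow> bool"
where
  "minimal_free_resolution I s D \<longleftrightarrow>
     graded_free_resolution I s D \<and>
     (\<forall>i. \<forall>r<length (s i). \<forall>c<length (s (Suc i)).
        Poly_Mapping.lookup (D (Suc i) $$ (r, c)) 0 = 0)"

text \<open>\<open>graded_betti I i j\<close> is the graded Betti number \<open>\<beta>\<^sub>i\<^sub>,\<^sub>j\<close> of \<open>R/I\<close>, for a homogeneous ideal \<open>I\<close>;
  minimal graded free resolutions are unique up to isomorphism.\<close>

definition graded_betti :: "('v::finite, 'k::field) mpoly set \<Rightarrow> nat \<Rightarrow> int \<Rightarrow> nat" where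
  "graded_betti I i j =
     (THE b. \<exists>s D. minimal_free_resolution I s D \<and> b = count_list (s i) j)"

definition regularity :: "('v::finite, 'k::field) mpoly set \<Rightarrow> int" where
  "regularity I = Max {j - int i | i j. graded_betti I i j \<noteq> 0}"


section \<open>The \<open>h\<close>-polynomial of a quotient ring\<close>

abbreviation k_dim :: "('v, 'k::field) mpoly set \<Rightarrow> nat" where
  "k_dim \<equiv> Vector_Spaces.vector_space.dim (\<lambda>c p. Poly_Mapping.single 0 c * p)"

text \<open>For a homogeneous ideal \<open>I\<close>, the degree \<open>d\<close> component of \<open>R/I\<close> is the quotient of the
  finite-dimensional space of forms of degree \<open>d\<close> by the subspace of those lying in \<open>I\<close>.\<close>

definition hilbert_function :: "('v::finite, 'k::field) mpoly set \<Rightarrow> nat \<Rightarrow> nat" where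
  "hilbert_function I d =
     k_dim {p :: ('v, 'k) mpoly. homogeneous (int d) p} - k_dim {p \<in> I. homogeneous (int d) p}"

definition hilbert_series :: "('v::finite, 'k::field) mpoly set \<Rightarrow> int fps" where
  "hilbert_series I = Abs_fps (\<lambda>d. int (hilbert_function I d))"

text \<open>The Krull dimension of \<open>R/I\<close>, whose prime ideals correspond to the prime ideals of \<open>R\<close>
  containing \<open>I\<close>: the largest length \<open>l\<close> of a chain \<open>P 0 \<subset> \<cdots> \<subset> P l\<close> of these.\<close>

definition krull_dim :: "('v::finite, 'k::field) mpoly set \<Rightarrow> nat" where
  "krull_dim I =
     Sup {l. \<exists>P :: nat \<Rightarrow> ('v, 'k) mpoly set.
            (\<forall>i\<le>l. prime_ideal (P i) \<and> I \<subseteq> P i) \<and> (\<forall>i<l. P i \<subset> P (Suc i))}"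

definition h_polynomial :: "('v::finite, 'k::field) mpoly set \<Rightarrow> int poly" where
  "h_polynomial I =
     (THE h. hilbert_series I * (1 - fps_X) ^ krull_dim I = fps_of_poly h)"


section \<open>The lower bound\<close>

definition q_min :: "nat \<Rightarrow> int" where
  "q_min n = Min ((\<lambda>c::int. c + \<lceil>of_nat n / of_int c :: rat\<rceil> - 3) ` {1..int n - 1})"

end

theory Submission
  imports Defs "HOL-Library.Countable"
begin

text \<open>Let \<open>C\<close> be the clique and \<open>-C\<close> the independent side of a connected split graph. If some vertex
of \<open>C\<close> has no neighbour outside \<open>C\<close>, it can be moved to the independent side; after that every
vertex \<open>v\<close> of \<open>C\<close> has a nonempty set \<open>nbhd v\<close> of neighbours in \<open>-C\<close>
(\<open>split_partition_exists\<close>). Write \<open>c\<close> for the size of \<open>C\<close> and \<open>d v\<close> for that of \<open>nbhd v\<close>.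
A set is a vertex cover iff it contains \<open>C\<close> or one of the sets \<open>(C - {v}) \<union> nbhd v\<close> with \<open>v \<in> C\<close>,
so the cover ideal \<open>J\<close> is generated by the monomial \<open>m\<^sub>0\<close> of \<open>C\<close> and the monomials \<open>m v\<close> of
these sets. Both invariants turn out to be \<open>c + max d - 2\<close>.

\<^emph>\<open>Regularity.\<close> All relations between the generators come from \<open>x\<^sub>v m v = y v m\<^sub>0\<close>, where
\<open>y v\<close> is the monomial of \<open>nbhd v\<close>. This gives a resolution of length two with generators in degrees
\<open>c\<close> and \<open>c - 1 + d v\<close> and relations in degrees \<open>c + d v\<close> (\<open>cover_ideal_resolution\<close>); it is minimal
because \<open>nbhd v\<close> is nonempty. To read off Betti numbers one needs that all minimal resolutions have
the same twists (\<open>graded_betti_eq_count\<close>): the identity lifts to graded chain maps both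
ways, their composite is homotopic to the identity, and modulo the variables the homotopy
terms vanish, so that the constant terms form mutually inverse matrices that preserve degrees.

\<^emph>\<open>The h-polynomial.\<close> A monomial in \<open>J\<close> is either a multiple of \<open>m\<^sub>0\<close> or avoids exactly one
\<open>v \<in> C\<close> and is a multiple of \<open>m v\<close>. Counting these by degree gives
\<open>(1 - t)\<^sup>n H(t) = 1 - t\<^sup>c - (1 - t) \<Sum>\<^sub>v t^(c - 1 + d v)\<close>, and dividing by \<open>(1 - t)\<^sup>2\<close> leaves a sum of
blocks of powers of \<open>t\<close> with nonnegative coefficients and top degree \<open>c + max d - 2\<close>
(\<open>degree_h_polynomial_cover\<close>). The dimension \<open>n - 2\<close> requires a bound on chains of primes
\<open>P\<^sub>0 \<subset> \<dots> \<subset> P\<^sub>l\<close> (\<open>prime_chain_length_le\<close>): elements \<open>f\<^sub>i \<in> P\<^sub>i\<^sub>+\<^sub>1 - P\<^sub>i\<close> are algebraically independent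
modulo \<open>P\<^sub>0\<close>, which is impossible for large \<open>l\<close> because there are too few monomials of bounded
degree in the variables outside \<open>P\<^sub>0\<close>.

\<^emph>\<open>Range.\<close> Since every vertex of \<open>-C\<close> has a neighbour in \<open>C\<close>, one has \<open>n - c \<le> c * max d\<close>, and
trivially \<open>max d \<le> n - c\<close>; this is the asserted range of \<open>c + max d - 2\<close>. Conversely, for the
minimising \<open>c\<close> and any admissible \<open>d\<close>, joining the vertices of a \<open>c\<close>-clique to windows of \<open>d\<close> consecutive
vertices that cover the other side realises every value (\<open>window_graph_exists\<close>).\<close>

section \<open>Polynomials, monomials and homogeneous components\<close>

text \<open>A polynomial maps exponent vectors to coefficients and an exponent vector maps variables to
exponents. Both are finitely supported functions, so lookup and support get separate names on
the two levels.\<close>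

abbreviation coef :: "('v, 'k::field) mpoly \<Rightarrow> ('v \<Rightarrow>\<^sub>0 nat) \<Rightarrow> 'k" where
  "coef \<equiv> Poly_Mapping.lookup"

abbreviation mons :: "('v, 'k::field) mpoly \<Rightarrow> ('v \<Rightarrow>\<^sub>0 nat) set" where
  "mons \<equiv> Poly_Mapping.keys"

abbreviation xpow :: "('v \<Rightarrow>\<^sub>0 nat) \<Rightarrow> ('v, 'k::field) mpoly" where
  "xpow m \<equiv> Poly_Mapping.single m 1"

abbreviation expo :: "('v \<Rightarrow>\<^sub>0 nat) \<Rightarrow> 'v \<Rightarrow> nat" where
  "expo \<equiv> Poly_Mapping.lookup"

abbreviation supp :: "('v \<Rightarrow>\<^sub>0 nat) \<Rightarrow> 'v set" where
  "supp \<equiv> Poly_Mapping.keys"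

lemma coef_single_mult_shift:
  "coef (Poly_Mapping.single m c * p) (m + k) = c * coef p k"
proof -
  have "coef (Poly_Mapping.single m c * p) (m + k)
      = (\<Sum>l. (c when m = l) * (\<Sum>q. (coef p q when m + k = l + q)))"
    by (simp add: lookup_mult lookup_single)
  also have "\<dots> = (\<Sum>l. (c * (\<Sum>q. (coef p q when m + k = l + q))) when m = l)"
    by (simp add: when_mult)
  also have "\<dots> = c * coef p k"
    by simp
  finally show ?thesis .
qed

lemma coef_single_mult_not_shift:
  assumes "k \<notin> range ((+) m)"
  shows "coef (Poly_Mapping.single m c * p) k = 0"
proof -
  have "mons (Poly_Mapping.single m c * p) \<subseteq> range ((+) m)"
    using keys_mult[of "Poly_Mapping.single m c" p] by (auto split: if_splits)
  then show ?thesis using assms by (auto simp: in_keys_iff)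
qed

lemma xpow_mult_cancel: "xpow m * p = xpow m * q \<longleftrightarrow> p = q"
proof
  assume "xpow m * p = xpow m * q"
  then have "coef p k = coef q k" for k
    using coef_single_mult_shift[of m 1 p k] coef_single_mult_shift[of m 1 q k] by simp
  then show "p = q" by (rule poly_mapping_eqI)
qed simp

lemma mpoly_expand: "p = (\<Sum>m\<in>mons p. Poly_Mapping.single m (coef p m))"
proof (rule poly_mapping_eqI)
  fix k
  have "coef (\<Sum>m\<in>mons p. Poly_Mapping.single m (coef p m)) k
      = (\<Sum>m\<in>mons p. if k = m then coef p m else 0)"
    by (auto simp: lookup_sum lookup_single when_def intro!: sum.cong)
  also have "\<dots> = coef p k" by (simp add: sum.delta' in_keys_iff)
  finally show "coef p k = coef (\<Sum>m\<in>mons p. Poly_Mapping.single m (coef p m)) k" by simp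
qed

lemma xpow_dvd_of_mons:
  assumes "\<And>k. k \<in> mons p \<Longrightarrow> k \<in> range ((+) m)"
  shows "\<exists>q. p = xpow m * q"
proof -
  have "p = (\<Sum>k\<in>mons p. Poly_Mapping.single k (coef p k))" by (rule mpoly_expand)
  also have "\<dots> = (\<Sum>k\<in>mons p. xpow m * Poly_Mapping.single (k - m) (coef p k))"
    using assms by (intro sum.cong refl) (force simp: mult_single)
  also have "\<dots> = xpow m * (\<Sum>k\<in>mons p. Poly_Mapping.single (k - m) (coef p k))"
    by (rule sum_distrib_left[symmetric])
  finally show ?thesis ..
qed

lemma range_shift_iff: "k \<in> range ((+) m) \<longleftrightarrow> (\<forall>v. expo m v \<le> expo k v)"
proof
  assume h: "\<forall>v. expo m v \<le> expo k v"
  have "k = m + (k - m)"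
    by (rule poly_mapping_eqI) (use h in \<open>simp add: lookup_add lookup_minus\<close>)
  then show "k \<in> range ((+) m)" by blast
qed (auto simp: lookup_add)

lemma exponent_add_eq_0: "a + b = (0 :: 'v \<Rightarrow>\<^sub>0 nat) \<longleftrightarrow> a = 0 \<and> b = 0"
proof
  assume "a + b = 0"
  then have "expo a v + expo b v = 0" for v by (metis lookup_add lookup_zero)
  then show "a = 0 \<and> b = 0" by (auto intro!: poly_mapping_eqI)
qed simp

text \<open>Exponent vectors have no nontrivial inverses, so a constant term of a product can only
arise from the two constant terms. Reduction modulo the variables is thus multiplicative.\<close>

lemma const_coef_mult: "coef (p * q) 0 = coef p 0 * coef q 0"
proof -
  have *: "coef (Poly_Mapping.single m c * q) 0 = coef (Poly_Mapping.single m c) 0 * coef q 0" for m c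
  proof (cases "m = 0")
    case True then show ?thesis using coef_single_mult_shift[of 0 c q 0] by simp
  next
    case False
    then have "0 \<notin> range ((+) m)" using exponent_add_eq_0[of m] by (metis rangeE)
    then show ?thesis using False by (simp add: coef_single_mult_not_shift lookup_single_not_eq)
  qed
  have "p * q = (\<Sum>m\<in>mons p. Poly_Mapping.single m (coef p m) * q)"
    by (subst mpoly_expand[of p]) (simp add: sum_distrib_right)
  then have "coef (p * q) 0 = (\<Sum>m\<in>mons p. coef (Poly_Mapping.single m (coef p m)) 0) * coef q 0"
    by (simp add: lookup_sum * sum_distrib_right)
  then show ?thesis by (simp flip: lookup_sum mpoly_expand)
qed

lemma mon_degree_add: "mon_degree (a + b) = mon_degree a + mon_degree b"
  by (simp add: mon_degree_def lookup_add sum.distrib)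

lemma mon_degree_0: "mon_degree 0 = 0" by (simp add: mon_degree_def)

lift_definition hom_component :: "int \<Rightarrow> ('v::finite, 'k::field) mpoly \<Rightarrow> ('v, 'k) mpoly" is
  "\<lambda>e p m. p m when int (mon_degree m) = e"
  by (rule finite_subset[rotated]) auto

lemma coef_hom_component: "coef (hom_component e p) m = (coef p m when int (mon_degree m) = e)"
  by transfer simp

lemma homogeneous_hom_component: "homogeneous e (hom_component e p)"
  by (auto simp: homogeneous_def in_keys_iff coef_hom_component when_def split: if_splits)

lemma hom_component_homogeneous: "homogeneous e p \<Longrightarrow> hom_component e p = p"
  by (intro poly_mapping_eqI) (auto simp: homogeneous_def in_keys_iff coef_hom_component when_def)

lemma hom_component_sum: "hom_component e (sum f A) = (\<Sum>a\<in>A. hom_component e (f a))"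
  by (intro poly_mapping_eqI) (simp add: coef_hom_component lookup_sum when_def)

lemma hom_component_add: "hom_component e (p + q) = hom_component e p + hom_component e q"
  by (intro poly_mapping_eqI) (simp add: coef_hom_component lookup_add when_def)

lemma homogeneous_mult: "homogeneous d p \<Longrightarrow> homogeneous e q \<Longrightarrow> homogeneous (d + e) (p * q)"
  using keys_mult[of p q] by (fastforce simp: homogeneous_def mon_degree_add)

lemma homogeneous_sum:
  assumes "\<And>a. a \<in> A \<Longrightarrow> homogeneous e (f a)"
  shows "homogeneous e (sum f A)"
proof -
  have "hom_component e (sum f A) = sum f A"
    unfolding hom_component_sum using assms by (intro sum.cong refl hom_component_homogeneous)
  then show ?thesis by (metis homogeneous_hom_component)
qed

lemma homogeneous_coef_0: "homogeneous e p \<Longrightarrow> coef p 0 \<noteq> 0 \<Longrightarrow> e = 0"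
  by (metis homogeneous_def in_keys_iff mon_degree_0 of_nat_0)

text \<open>Multiplying by a form of degree \<open>d\<close> shifts the grading by \<open>d\<close>. This is what makes it possible
to replace any solution of a graded linear system by a homogeneous one.\<close>

lemma hom_component_mult:
  assumes "homogeneous d p"
  shows "hom_component e (p * q) = p * hom_component (e - d) q"
proof -
  have *: "hom_component e (Poly_Mapping.single m c * q) = Poly_Mapping.single m c * hom_component (e - d) q"
    if "int (mon_degree m) = d" for m c
  proof (rule poly_mapping_eqI)
    fix k
    show "coef (hom_component e (Poly_Mapping.single m c * q)) k
        = coef (Poly_Mapping.single m c * hom_component (e - d) q) k"
    proof (cases "k \<in> range ((+) m)")
      case True
      then obtain l where "k = m + l" by auto
      then show ?thesis using that
        by (auto simp: coef_hom_component coef_single_mult_shift mon_degree_add when_def)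
    next
      case False
      then show ?thesis by (simp add: coef_hom_component coef_single_mult_not_shift)
    qed
  qed
  have "hom_component e (p * q) = (\<Sum>m\<in>mons p. hom_component e (Poly_Mapping.single m (coef p m) * q))"
    by (subst mpoly_expand[of p]) (simp add: sum_distrib_right hom_component_sum)
  also have "\<dots> = (\<Sum>m\<in>mons p. Poly_Mapping.single m (coef p m) * hom_component (e - d) q)"
    using assms by (intro sum.cong * refl) (auto simp: homogeneous_def)
  also have "\<dots> = p * hom_component (e - d) q"
    by (subst (2) mpoly_expand[of p]) (simp add: sum_distrib_right)
  finally show ?thesis .
qed

section \<open>Ideals and linear independence\<close>

interpretation ideals: Modules.module "(*) :: 'a::comm_ring_1 \<Rightarrow> 'a \<Rightarrow> 'a"
  by unfold_locales (simp_all add: algebra_simps)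

text \<open>Over the ring itself this rule is associativity of multiplication, oriented against
the normal form of \<open>ac_simps\<close>; together they would loop.\<close>

declare ideals.scale_scale [simp del]

lemma vector_space_poly_mapping:
  "Vector_Spaces.vector_space (\<lambda>(c::'k::field) (p :: 'a::comm_monoid_add \<Rightarrow>\<^sub>0 'k). Poly_Mapping.single 0 c * p)"
  by unfold_locales (simp_all add: distrib_left distrib_right single_add mult_single flip: mult.assoc)

interpretation kvs: Vector_Spaces.vector_space
  "\<lambda>(c::'k::field) (p :: 'a::comm_monoid_add \<Rightarrow>\<^sub>0 'k). Poly_Mapping.single 0 c * p"
  by (rule vector_space_poly_mapping)

declare kvs.scale_scale [simp del]

text \<open>Linear independence of an indexed family rather than of a set, so that independence includes
injectivity of the family and cardinalities can be compared on the index sets.\<close>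

definition indep_family ::
  "'i set \<Rightarrow> ('i \<Rightarrow> ('a::comm_monoid_add \<Rightarrow>\<^sub>0 'k::field)) \<Rightarrow> bool" where
  "indep_family A f \<longleftrightarrow>
     (\<forall>c. (\<Sum>a\<in>A. Poly_Mapping.single 0 (c a) * f a) = 0 \<longrightarrow> (\<forall>a\<in>A. c a = 0))"

lemma indep_familyD:
  assumes "indep_family A f" "(\<Sum>a\<in>A. Poly_Mapping.single 0 (c a) * f a) = 0" "a \<in> A"
  shows "c a = 0"
  using assms by (auto simp: indep_family_def)

lemma indep_family_inj:
  fixes f :: "'i \<Rightarrow> ('a::comm_monoid_add \<Rightarrow>\<^sub>0 'k::field)"
  assumes A: "finite A" and f: "indep_family A f"
  shows "inj_on f A"
proof (rule inj_onI, rule ccontr)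
  fix a b assume ab: "a \<in> A" "b \<in> A" "f a = f b" "a \<noteq> b"
  define c :: "'i \<Rightarrow> 'k" where "c i = (if i = a then 1 else if i = b then -1 else 0)" for i
  have "(\<Sum>i\<in>A. Poly_Mapping.single 0 (c i) * f i)
      = (\<Sum>i\<in>{a, b}. Poly_Mapping.single 0 (c i) * f i)"
    using A ab by (intro sum.mono_neutral_right) (auto simp: c_def)
  also have "\<dots> = 0"
    using ab by (simp add: c_def single_uminus)
  finally have "c a = 0" using indep_familyD[OF f _ ab(1), of c] by simp
  then show False by (simp add: c_def)
qed

lemma indep_family_independent:
  fixes f :: "'i \<Rightarrow> ('a::comm_monoid_add \<Rightarrow>\<^sub>0 'k::field)"
  assumes A: "finite A" and f: "indep_family A f"
  shows "kvs.independent (f ` A)"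
proof (rule kvs.independent_if_scalars_zero)
  show "finite (f ` A)" using A by simp
next
  fix u x
  assume u: "(\<Sum>x\<in>f ` A. Poly_Mapping.single 0 (u x) * x) = 0" and x: "x \<in> f ` A"
  have "(\<Sum>a\<in>A. Poly_Mapping.single 0 (u (f a)) * f a) = 0"
    using u indep_family_inj[OF A f] by (simp add: sum.reindex)
  then show "u x = 0" using indep_familyD[OF f, of "u \<circ> f"] x by auto
qed

text \<open>The Steinitz bound in terms of index sets. It will be applied to the columns of a matrix of
constants and to power products along a chain of primes.\<close>

lemma indep_family_card_le:
  fixes f :: "'i \<Rightarrow> ('a::comm_monoid_add \<Rightarrow>\<^sub>0 'k::field)"
  assumes "finite A" "indep_family A f" "finite B" "f ` A \<subseteq> kvs.span B"
  shows "card A \<le> card B"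
  using kvs.independent_span_bound[OF assms(3) indep_family_independent[OF assms(1,2)] assms(4)]
    card_image[OF indep_family_inj[OF assms(1,2)]] by simp

lemma indep_family_monomials:
  "finite A \<Longrightarrow> indep_family A (\<lambda>a. Poly_Mapping.single a (1::'k::field))"
  unfolding indep_family_def
proof (intro allI impI ballI)
  fix c :: "'a \<Rightarrow> 'k" and a
  assume A: "finite A" and s: "(\<Sum>a\<in>A. Poly_Mapping.single 0 (c a) * Poly_Mapping.single a 1) = 0"
    and a: "a \<in> A"
  have "Poly_Mapping.lookup (\<Sum>b\<in>A. Poly_Mapping.single 0 (c b) * Poly_Mapping.single b 1) a = c a"
    using A a by (simp add: mult_single lookup_sum lookup_single when_def sum.delta)
  then show "c a = 0" using s by simp
qed

lemma span_monomials:
  fixes p :: "'a::comm_monoid_add \<Rightarrow>\<^sub>0 'k::field"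
  assumes "Poly_Mapping.keys p \<subseteq> M"
  shows "p \<in> kvs.span ((\<lambda>a. Poly_Mapping.single a 1) ` M)"
proof -
  have "p = (\<Sum>m\<in>Poly_Mapping.keys p. Poly_Mapping.single m (Poly_Mapping.lookup p m))"
  proof (rule poly_mapping_eqI)
    fix k
    show "Poly_Mapping.lookup p k = Poly_Mapping.lookup (\<Sum>m\<in>Poly_Mapping.keys p.
        Poly_Mapping.single m (Poly_Mapping.lookup p m)) k"
      by (simp add: lookup_sum lookup_single when_def sum.delta in_keys_iff)
  qed
  also have "\<dots> = (\<Sum>m\<in>Poly_Mapping.keys p.
      Poly_Mapping.single 0 (Poly_Mapping.lookup p m) * Poly_Mapping.single m 1)"
    by (simp add: mult_single)
  also have "\<dots> \<in> kvs.span ((\<lambda>a. Poly_Mapping.single a 1) ` M)"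
    using assms by (intro kvs.span_sum kvs.span_scale kvs.span_base) auto
  finally show ?thesis .
qed

definition monomial_ideal :: "('v \<Rightarrow>\<^sub>0 nat) set \<Rightarrow> ('v, 'k::field) mpoly set" where
  "monomial_ideal M = {p. mons p \<subseteq> M}"

lemma monomial_ideal_subspace:
  fixes M :: "('v \<Rightarrow>\<^sub>0 nat) set"
  assumes "\<And>m k. m \<in> M \<Longrightarrow> k + m \<in> M"
  shows "ideals.subspace (monomial_ideal M :: ('v, 'k::field) mpoly set)"
proof (rule ideals.subspaceI)
  fix c p :: "('v, 'k::field) mpoly"
  assume "p \<in> monomial_ideal M"
  then show "c * p \<in> monomial_ideal M"
    using keys_mult[of c p] assms by (fastforce simp: monomial_ideal_def)
qed (use keys_add in \<open>fastforce simp: monomial_ideal_def\<close>)+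

section \<open>Uniqueness of minimal graded free resolutions\<close>

text \<open>The matrices of degree-preserving maps from the sum of the \<open>R(-j)\<close>, \<open>j\<close> in \<open>s\<close>, to that for \<open>t\<close>.\<close>

definition homog_mat :: "int list \<Rightarrow> int list \<Rightarrow> ('v::finite, 'k::field) mpoly mat \<Rightarrow> bool" where
  "homog_mat t s M \<longleftrightarrow> M \<in> carrier_mat (length t) (length s) \<and>
     (\<forall>r<length t. \<forall>c<length s. homogeneous (s ! c - t ! r) (M $$ (r, c)))"

lemma mat_mult_entry:
  assumes "A \<in> carrier_mat n l" "B \<in> carrier_mat l k" "r < n" "c < k"
  shows "(A * B) $$ (r, c) = (\<Sum>i<l. A $$ (r, i) * B $$ (i, c))"
  using assms by (auto simp: scalar_prod_def lessThan_atLeast0 intro!: sum.cong)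

lemma mat_vec_mult_entry:
  assumes "A \<in> carrier_mat n l" "w \<in> carrier_vec l" "r < n"
  shows "(A *\<^sub>v w) $ r = (\<Sum>i<l. A $$ (r, i) * w $ i)"
  using assms by (auto simp: scalar_prod_def lessThan_atLeast0 intro!: sum.cong)

lemma minus_mat_entry:
  assumes "A \<in> carrier_mat n k" "B \<in> carrier_mat n k" "r < n" "c < k"
  shows "(A - B) $$ (r, c) = A $$ (r, c) - B $$ (r, c)"
  using assms by (intro index_minus_mat) auto

lemma mat_unit_vec_col:
  fixes A :: "'a::comm_ring_1 mat"
  assumes A: "A \<in> carrier_mat n l" and j: "j < l"
  shows "A *\<^sub>v unit_vec l j = col A j"
  using col_mult2[OF A one_carrier_mat j] A j by simp

lemma homog_mat_mult:
  assumes "homog_mat a b A" "homog_mat b c B"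
  shows "homog_mat a c (A * B)"
  unfolding homog_mat_def
proof (intro conjI allI impI)
  show "A * B \<in> carrier_mat (length a) (length c)"
    using assms by (auto simp: homog_mat_def)
next
  fix r j assume rj: "r < length a" "j < length c"
  have "(A * B) $$ (r, j) = (\<Sum>i<length b. A $$ (r, i) * B $$ (i, j))"
    using assms rj by (intro mat_mult_entry) (auto simp: homog_mat_def)
  also have "homogeneous (c ! j - a ! r) \<dots>"
  proof (rule homogeneous_sum)
    fix i assume "i \<in> {..<length b}"
    then have "homogeneous ((b ! i - a ! r) + (c ! j - b ! i)) (A $$ (r, i) * B $$ (i, j))"
      using assms rj by (intro homogeneous_mult) (auto simp: homog_mat_def)
    then show "homogeneous (c ! j - a ! r) (A $$ (r, i) * B $$ (i, j))" by simp
  qed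
  finally show "homogeneous (c ! j - a ! r) ((A * B) $$ (r, j))" .
qed

definition graded_part ::
  "int list \<Rightarrow> int list \<Rightarrow> ('v::finite, 'k::field) mpoly mat \<Rightarrow> ('v, 'k) mpoly mat" where
  "graded_part t s X = mat (length t) (length s) (\<lambda>(r, c). hom_component (s ! c - t ! r) (X $$ (r, c)))"

lemma homog_mat_graded_part: "homog_mat t s (graded_part t s X)"
  by (auto simp: homog_mat_def graded_part_def homogeneous_hom_component)

text \<open>The degree-preserving part of a map commutes with composition by a graded map, because
multiplication by the entries of \<open>E\<close> shifts degrees by the right amount.\<close>

lemma mult_graded_part:
  assumes E: "homog_mat a b E" and X: "X \<in> carrier_mat (length b) (length c)"
    and rj: "r < length a" "j < length c"
  shows "(E * graded_part b c X) $$ (r, j) = hom_component (c ! j - a ! r) ((E * X) $$ (r, j))"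
proof -
  have Ec: "E \<in> carrier_mat (length a) (length b)" using E by (simp add: homog_mat_def)
  have "(E * graded_part b c X) $$ (r, j)
      = (\<Sum>i<length b. E $$ (r, i) * hom_component (c ! j - b ! i) (X $$ (i, j)))"
    using rj by (subst mat_mult_entry[OF Ec, where k = "length c"]) (auto simp: graded_part_def)
  also have "\<dots> = (\<Sum>i<length b. hom_component (c ! j - a ! r) (E $$ (r, i) * X $$ (i, j)))"
  proof (rule sum.cong[OF refl])
    fix i assume "i \<in> {..<length b}"
    then have "homogeneous (b ! i - a ! r) (E $$ (r, i))" using E rj by (auto simp: homog_mat_def)
    from hom_component_mult[OF this, of "c ! j - a ! r" "X $$ (i, j)"]
    show "E $$ (r, i) * hom_component (c ! j - b ! i) (X $$ (i, j))
        = hom_component (c ! j - a ! r) (E $$ (r, i) * X $$ (i, j))" by simp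
  qed
  also have "\<dots> = hom_component (c ! j - a ! r) ((E * X) $$ (r, j))"
    by (simp add: hom_component_sum mat_mult_entry[OF Ec X rj])
  finally show ?thesis .
qed

lemma factor_through_image:
  assumes M: "M \<in> carrier_mat n k" and E: "E \<in> carrier_mat n l"
    and im: "\<And>j. j < k \<Longrightarrow> col M j \<in> (*\<^sub>v) E ` carrier_vec l"
  shows "\<exists>X\<in>carrier_mat l k. E * X = M"
proof -
  have "\<forall>j. \<exists>w. j < k \<longrightarrow> w \<in> carrier_vec l \<and> col M j = E *\<^sub>v w" using im by blast
  then obtain w where w: "\<And>j. j < k \<Longrightarrow> w j \<in> carrier_vec l \<and> col M j = E *\<^sub>v w j"
    by metis
  define X where "X = mat l k (\<lambda>(i, j). w j $ i)"
  have X: "X \<in> carrier_mat l k" by (simp add: X_def)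
  have colX: "col X j = w j" if "j < k" for j
    using w[OF that] that by (auto simp: X_def)
  have "E * X = M"
  proof (rule mat_col_eqI)
    fix j assume "j < dim_col M"
    then have j: "j < k" using M by auto
    show "col (E * X) j = col M j"
      using col_mult2[OF E X j] colX[OF j] w[OF j] by simp
  qed (use E M X in auto)
  then show ?thesis using X by blast
qed

text \<open>An arbitrary lift exists column by column; its degree-preserving part is still a lift.\<close>

lemma factor_through_image_homogeneous:
  assumes M: "homog_mat a c M" and E: "homog_mat a b E"
    and im: "\<And>j. j < length c \<Longrightarrow> col M j \<in> (*\<^sub>v) E ` carrier_vec (length b)"
  shows "\<exists>X. homog_mat b c X \<and> E * X = M"
proof -
  have Mc: "M \<in> carrier_mat (length a) (length c)" and Ec: "E \<in> carrier_mat (length a) (length b)"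
    using M E by (auto simp: homog_mat_def)
  obtain X where X: "X \<in> carrier_mat (length b) (length c)" "E * X = M"
    using factor_through_image[OF Mc Ec im] by blast
  have "E * graded_part b c X = M"
  proof (rule eq_matI)
    fix r j assume "r < dim_row M" "j < dim_col M"
    then have rj: "r < length a" "j < length c" using Mc by auto
    then show "(E * graded_part b c X) $$ (r, j) = M $$ (r, j)"
      using mult_graded_part[OF E X(1) rj] X(2) M by (auto simp: homog_mat_def hom_component_homogeneous)
  qed (use Mc Ec in \<open>auto simp: graded_part_def\<close>)
  then show ?thesis using homog_mat_graded_part by blast
qed

lemma resolutionD:
  assumes "graded_free_resolution I s D"
  shows resolution_homog_0: "homog_mat [0] (s 0) (D 0)"
    and resolution_homog_Suc: "homog_mat (s i) (s (Suc i)) (D (Suc i))"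
    and resolution_carrier_0: "D 0 \<in> carrier_mat 1 (length (s 0))"
    and resolution_carrier_Suc: "D (Suc i) \<in> carrier_mat (length (s i)) (length (s (Suc i)))"
    and resolution_surj: "\<exists>w\<in>carrier_vec (length (s 0)). p - (D 0 *\<^sub>v w) $ 0 \<in> I"
    and resolution_exact_0: "w \<in> carrier_vec (length (s 0)) \<Longrightarrow> (D 0 *\<^sub>v w) $ 0 \<in> I \<Longrightarrow>
          w \<in> (*\<^sub>v) (D 1) ` carrier_vec (length (s 1))"
    and resolution_complex_0: "u \<in> carrier_vec (length (s 1)) \<Longrightarrow> (D 0 *\<^sub>v (D 1 *\<^sub>v u)) $ 0 \<in> I"
    and resolution_exact_Suc: "v \<in> carrier_vec (length (s (Suc i))) \<Longrightarrow>
          D (Suc i) *\<^sub>v v = 0\<^sub>v (length (s i)) \<Longrightarrow>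
          v \<in> (*\<^sub>v) (D (Suc (Suc i))) ` carrier_vec (length (s (Suc (Suc i))))"
    and resolution_complex_Suc: "D (Suc i) * D (Suc (Suc i))
          = 0\<^sub>m (length (s i)) (length (s (Suc (Suc i))))"
proof -
  note R = assms[unfolded graded_free_resolution_def]
  note R1 = R[THEN conjunct1] and R2 = R[THEN conjunct2, THEN conjunct1]
    and R3 = R[THEN conjunct2, THEN conjunct2, THEN conjunct1]
  note R' = R[THEN conjunct2, THEN conjunct2, THEN conjunct2]
  note R4 = R'[THEN conjunct1] and R5 = R'[THEN conjunct2, THEN conjunct1]
    and e0 = R'[THEN conjunct2, THEN conjunct2, THEN conjunct1]
    and e = R'[THEN conjunct2, THEN conjunct2, THEN conjunct2, rule_format]
  have c: "D (Suc i) \<in> carrier_mat (length (s i)) (length (s (Suc i)))" for i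
    using R3 by (rule spec)
  show "homog_mat [0] (s 0) (D 0)" using R1 R2 by (simp add: homog_mat_def)
  show "homog_mat (s i) (s (Suc i)) (D (Suc i))" using c[of i] R4 by (simp add: homog_mat_def)
  show c0: "D 0 \<in> carrier_mat 1 (length (s 0))" by (rule R1)
  show "D (Suc i) \<in> carrier_mat (length (s i)) (length (s (Suc i)))" by (rule c)
  show "\<exists>w\<in>carrier_vec (length (s 0)). p - (D 0 *\<^sub>v w) $ 0 \<in> I" using R5 by (rule spec)
  show "w \<in> (*\<^sub>v) (D 1) ` carrier_vec (length (s 1))"
    if "w \<in> carrier_vec (length (s 0))" "(D 0 *\<^sub>v w) $ 0 \<in> I"
    unfolding e0[symmetric] using that by simp
  show "(D 0 *\<^sub>v (D 1 *\<^sub>v u)) $ 0 \<in> I" if "u \<in> carrier_vec (length (s 1))"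
    using imageI[OF that, of "(*\<^sub>v) (D 1)"] unfolding e0[symmetric] by simp
  show "v \<in> (*\<^sub>v) (D (Suc (Suc i))) ` carrier_vec (length (s (Suc (Suc i))))"
    if "v \<in> carrier_vec (length (s (Suc i)))" "D (Suc i) *\<^sub>v v = 0\<^sub>v (length (s i))"
    unfolding e[symmetric] using that by (rule mat_kernelI[OF c])
  show "D (Suc i) * D (Suc (Suc i)) = 0\<^sub>m (length (s i)) (length (s (Suc (Suc i))))"
  proof (rule mat_col_eqI)
    fix j assume "j < dim_col (0\<^sub>m (length (s i)) (length (s (Suc (Suc i)))))"
    then have j: "j < length (s (Suc (Suc i)))" by simp
    have "col (D (Suc (Suc i))) j = D (Suc (Suc i)) *\<^sub>v unit_vec (length (s (Suc (Suc i)))) j"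
      using mat_unit_vec_col[OF c j] by simp
    then have "col (D (Suc (Suc i))) j \<in> mat_kernel (D (Suc i))" using e[of i] by auto
    from mat_kernelD[OF c this] have "D (Suc i) *\<^sub>v col (D (Suc (Suc i))) j = 0\<^sub>v (length (s i))"
      by blast
    then show "col (D (Suc i) * D (Suc (Suc i))) j
        = col (0\<^sub>m (length (s i)) (length (s (Suc (Suc i))))) j"
      using col_mult2[OF c c j] j by simp
  qed (use c[of i] c[of "Suc i"] in auto)
qed

lemma col_in_kernel_image:
  assumes R: "graded_free_resolution I s D"
    and M: "M \<in> carrier_mat (length (s (Suc i))) k"
    and z: "D (Suc i) * M = 0\<^sub>m (length (s i)) k" and j: "j < k"
  shows "col M j \<in> (*\<^sub>v) (D (Suc (Suc i))) ` carrier_vec (length (s (Suc (Suc i))))"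
proof (rule resolution_exact_Suc[OF R])
  show "D (Suc i) *\<^sub>v col M j = 0\<^sub>v (length (s i))"
    using col_mult2[OF resolution_carrier_Suc[OF R] M j] z j by simp
qed (use M j in auto)

lemma combination_in_ideal:
  assumes I: "ideals.subspace I" and M: "M \<in> carrier_mat 1 n"
    and ent: "\<And>c. c < n \<Longrightarrow> M $$ (0, c) \<in> I" and w: "w \<in> carrier_vec n"
  shows "(M *\<^sub>v w) $ 0 \<in> I"
proof -
  have "(M *\<^sub>v w) $ 0 = (\<Sum>c<n. w $ c * M $$ (0, c))"
    using mat_vec_mult_entry[OF M w] by (simp add: mult.commute)
  also have "\<dots> \<in> I"
    by (intro ideals.subspace_sum[OF I] ideals.subspace_scale[OF I] ent) auto
  finally show ?thesis .
qed

text \<open>The identity of \<open>R/I\<close> lifts to a graded chain map between any two resolutions. Step by step,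
the next matrix exists because the composite of the previous one with the differential lands in
a kernel, hence in an image. In degree \<open>0\<close> the lift is only correct modulo \<open>I\<close>, and taking
homogeneous parts there uses that \<open>I\<close> is closed under homogeneous components.\<close>

lemma comparison_map_exists:
  fixes D E :: "nat \<Rightarrow> ('v::finite, 'k::field) mpoly mat"
  assumes R: "graded_free_resolution I s D" and S: "graded_free_resolution I t E"
    and I: "ideals.subspace I" and hI: "\<And>e p. p \<in> I \<Longrightarrow> hom_component e p \<in> I"
  shows "\<exists>A. (\<forall>i. homog_mat (t i) (s i) (A i)) \<and>
             (\<forall>c<length (s 0). (D 0 - E 0 * A 0) $$ (0, c) \<in> I) \<and>
             (\<forall>i. E (Suc i) * A (Suc i) = A i * D (Suc i))"
proof -
  define P where "P n X \<longleftrightarrow> homog_mat (t n) (s n) X \<and>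
      (n = 0 \<longrightarrow> (\<forall>c<length (s 0). (D 0 - E 0 * X) $$ (0, c) \<in> I)) \<and>
      (\<forall>j<length (s (Suc n)). col (X * D (Suc n)) j
          \<in> (*\<^sub>v) (E (Suc n)) ` carrier_vec (length (t (Suc n))))" for n X
  define Q where "Q n X Y \<longleftrightarrow> E (Suc n) * Y = X * D (Suc n)" for n :: nat and X Y
  note D0 = resolution_carrier_0[OF R] and E0 = resolution_carrier_0[OF S]
  note Dc = resolution_carrier_Suc[OF R] and Ec = resolution_carrier_Suc[OF S]
  have "\<exists>X. P 0 X"
  proof -
    obtain w where w: "\<And>p. w p \<in> carrier_vec (length (t 0)) \<and> p - (E 0 *\<^sub>v w p) $ 0 \<in> I"
      using resolution_surj[OF S] by metis
    define X where "X = mat (length (t 0)) (length (s 0)) (\<lambda>(i, j). w (D 0 $$ (0, j)) $ i)"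
    define Y where "Y = graded_part (t 0) (s 0) X"
    have X: "X \<in> carrier_mat (length (t 0)) (length (s 0))" by (simp add: X_def)
    have Y: "homog_mat (t 0) (s 0) Y" unfolding Y_def by (rule homog_mat_graded_part)
    have Yc: "Y \<in> carrier_mat (length (t 0)) (length (s 0))" using Y by (simp add: homog_mat_def)
    have aug: "(D 0 - E 0 * Y) $$ (0, c) \<in> I" if c: "c < length (s 0)" for c
    proof -
      have colX: "col X c = w (D 0 $$ (0, c))"
        using c w[of "D 0 $$ (0, c)"] by (auto simp: X_def)
      have "(E 0 * X) $$ (0, c) = (E 0 *\<^sub>v w (D 0 $$ (0, c))) $ 0"
        using E0 X c colX by auto
      then have "D 0 $$ (0, c) - (E 0 * X) $$ (0, c) \<in> I" using w by simp
      then have "hom_component (s 0 ! c) (D 0 $$ (0, c) - (E 0 * X) $$ (0, c)) \<in> I" by (rule hI)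
      moreover have "hom_component (s 0 ! c) (D 0 $$ (0, c) - (E 0 * X) $$ (0, c))
          = D 0 $$ (0, c) - (E 0 * Y) $$ (0, c)"
      proof -
        have "(E 0 * Y) $$ (0, c) = hom_component (s 0 ! c) ((E 0 * X) $$ (0, c))"
          using mult_graded_part[OF resolution_homog_0[OF S] X, of 0 c] c by (simp add: Y_def)
        moreover have "hom_component (s 0 ! c) (D 0 $$ (0, c)) = D 0 $$ (0, c)"
          using resolution_homog_0[OF R] c by (intro hom_component_homogeneous) (auto simp: homog_mat_def)
        moreover have "hom_component e (p - q) = hom_component e p - hom_component e q" for e and p q :: "('v, 'k) mpoly"
          using hom_component_add[of e "p - q" q] by simp
        ultimately show ?thesis by simp
      qed
      ultimately show ?thesis using D0 E0 Yc c by simp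
    qed
    have "col (Y * D 1) j \<in> (*\<^sub>v) (E 1) ` carrier_vec (length (t 1))" if j: "j < length (s 1)" for j
    proof (rule resolution_exact_0[OF S])
      have D1: "D 1 \<in> carrier_mat (length (s 0)) (length (s 1))" using Dc[of 0] by simp
      define u where "u = col (D 1) j"
      have u: "u \<in> carrier_vec (length (s 0))" using D1 j by (auto simp: u_def)
      have uD: "u = D 1 *\<^sub>v unit_vec (length (s 1)) j" using mat_unit_vec_col[OF D1 j] by (simp add: u_def)
      have c: "col (Y * D 1) j = Y *\<^sub>v u" using col_mult2[OF Yc D1 j] by (simp add: u_def)
      then show "col (Y * D 1) j \<in> carrier_vec (length (t 0))" using Yc u by auto
      have EY: "E 0 * Y \<in> carrier_mat 1 (length (s 0))" using E0 Yc by auto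
      have "((D 0 - E 0 * Y) *\<^sub>v u) $ 0 \<in> I"
        by (rule combination_in_ideal[OF I minus_carrier_mat[OF EY] aug u])
      moreover have "(D 0 *\<^sub>v u) $ 0 \<in> I" unfolding uD by (rule resolution_complex_0[OF R]) simp
      ultimately have "(D 0 *\<^sub>v u) $ 0 - ((D 0 - E 0 * Y) *\<^sub>v u) $ 0 \<in> I"
        by (rule ideals.subspace_diff[OF I, rotated])
      moreover have "((D 0 - E 0 * Y) *\<^sub>v u) $ 0 = (D 0 *\<^sub>v u) $ 0 - (E 0 *\<^sub>v (Y *\<^sub>v u)) $ 0"
        using D0 E0 Yc u EY
        by (subst minus_mult_distrib_mat_vec[OF D0 EY u], subst assoc_mult_mat_vec[OF E0 Yc u]) auto
      ultimately show "(E 0 *\<^sub>v col (Y * D 1) j) $ 0 \<in> I" using c by simp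
    qed
    then show ?thesis using Y aug unfolding P_def by auto
  qed
  moreover have "\<exists>Y. P (Suc n) Y \<and> Q n X Y" if "P n X" for n X
  proof -
    have X: "homog_mat (t n) (s n) X" and Xc: "X \<in> carrier_mat (length (t n)) (length (s n))"
      using that by (auto simp: P_def homog_mat_def)
    have im: "col (X * D (Suc n)) j \<in> (*\<^sub>v) (E (Suc n)) ` carrier_vec (length (t (Suc n)))"
      if "j < length (s (Suc n))" for j
      using \<open>P n X\<close> that by (simp add: P_def)
    obtain Y where Y: "homog_mat (t (Suc n)) (s (Suc n)) Y" "E (Suc n) * Y = X * D (Suc n)"
      using factor_through_image_homogeneous[OF homog_mat_mult[OF X resolution_homog_Suc[OF R]]
          resolution_homog_Suc[OF S] im] by blast
    have Yc: "Y \<in> carrier_mat (length (t (Suc n))) (length (s (Suc n)))"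
      using Y by (simp add: homog_mat_def)
    have YD: "Y * D (Suc (Suc n)) \<in> carrier_mat (length (t (Suc n))) (length (s (Suc (Suc n))))"
      using Yc Dc[of "Suc n"] by auto
    have "E (Suc n) * (Y * D (Suc (Suc n))) = X * (D (Suc n) * D (Suc (Suc n)))"
      using assoc_mult_mat[OF Ec Yc Dc] assoc_mult_mat[OF Xc Dc Dc] Y(2) by simp
    also have "\<dots> = 0\<^sub>m (length (t n)) (length (s (Suc (Suc n))))"
      using resolution_complex_Suc[OF R] Xc by simp
    finally show ?thesis
      using col_in_kernel_image[OF S YD] Y unfolding P_def Q_def by blast
  qed
  ultimately obtain A where "\<And>n. P n (A n) \<and> Q n (A n) (A (Suc n))"
    using dependent_nat_choice[of P Q] by blast
  then show ?thesis unfolding P_def Q_def by metis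
qed

lemma const_coef_mat_mult:
  assumes "A \<in> carrier_mat n l" "B \<in> carrier_mat l k" "r < n" "c < k"
  shows "coef ((A * B) $$ (r, c)) 0 = (\<Sum>i<l. coef (A $$ (r, i)) 0 * coef (B $$ (i, c)) 0)"
  by (simp add: mat_mult_entry[OF assms] lookup_sum const_coef_mult)

text \<open>A chain map \<open>C\<close> that induces zero on \<open>R/I\<close> is homotopic to zero, \<open>C\<^sub>i = D\<^sub>i\<^sub>+\<^sub>1 h\<^sub>i + h\<^sub>i\<^sub>-\<^sub>1 D\<^sub>i\<close>. For a
minimal resolution the right hand side vanishes modulo the variables. The induction carries
\<open>D\<^sub>i\<^sub>+\<^sub>1 h\<^sub>i D\<^sub>i\<^sub>+\<^sub>1 = C\<^sub>i D\<^sub>i\<^sub>+\<^sub>1\<close> instead of the homotopy identity: this is all that the construction of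
\<open>h\<^sub>i\<^sub>+\<^sub>1\<close> requires, and it involves one homotopy at a time.\<close>

lemma nullhomotopic_const_coef:
  fixes D C :: "nat \<Rightarrow> ('v::finite, 'k::field) mpoly mat"
  assumes min: "minimal_free_resolution I s D"
    and C: "\<And>i. C i \<in> carrier_mat (length (s i)) (length (s i))"
    and aug: "\<And>c. c < length (s 0) \<Longrightarrow> (D 0 * C 0) $$ (0, c) \<in> I"
    and chain: "\<And>i. D (Suc i) * C (Suc i) = C i * D (Suc i)"
    and rc: "r < length (s i)" "c < length (s i)"
  shows "coef (C i $$ (r, c)) 0 = 0"
proof -
  have R: "graded_free_resolution I s D" using min by (simp add: minimal_free_resolution_def)
  have m: "coef (D (Suc i) $$ (r, c)) 0 = 0" if "r < length (s i)" "c < length (s (Suc i))" for i r c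
    using min that by (simp add: minimal_free_resolution_def)
  note Dc = resolution_carrier_Suc[OF R]
  have "\<exists>h\<in>carrier_mat (length (s (Suc i))) (length (s i)).
          D (Suc i) * (h * D (Suc i)) = C i * D (Suc i) \<and>
          (\<forall>r<length (s i). \<forall>c<length (s i). coef (C i $$ (r, c)) 0 = 0)"
  proof (induction i)
    case 0
    have "col (C 0) j \<in> (*\<^sub>v) (D 1) ` carrier_vec (length (s 1))" if j: "j < length (s 0)" for j
    proof (rule resolution_exact_0[OF R])
      show "(D 0 *\<^sub>v col (C 0) j) $ 0 \<in> I"
        using aug[OF j] j resolution_carrier_0[OF R] C[of 0] by simp
    qed (use C[of 0] j in auto)
    then obtain h where h: "h \<in> carrier_mat (length (s 1)) (length (s 0))" "D 1 * h = C 0"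
      using factor_through_image[OF C[of 0], of "D 1"] Dc[of 0] by auto
    have D1: "D 1 \<in> carrier_mat (length (s 0)) (length (s 1))" using Dc[of 0] by simp
    have "D 1 * (h * D 1) = C 0 * D 1" using assoc_mult_mat[OF D1 h(1) D1] h(2) by simp
    moreover have "coef (C 0 $$ (r, c)) 0 = 0" if "r < length (s 0)" "c < length (s 0)" for r c
      using const_coef_mat_mult[OF D1 h(1) that] h(2) m[of r 0] that by simp
    ultimately show ?case using h(1) by auto
  next
    case (Suc i)
    then obtain h where h: "h \<in> carrier_mat (length (s (Suc i))) (length (s i))"
      and hD: "D (Suc i) * (h * D (Suc i)) = C i * D (Suc i)" by blast
    define M where "M = C (Suc i) - h * D (Suc i)"
    have hDc: "h * D (Suc i) \<in> carrier_mat (length (s (Suc i))) (length (s (Suc i)))"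
      using h Dc[of i] by auto
    have M: "M \<in> carrier_mat (length (s (Suc i))) (length (s (Suc i)))"
      unfolding M_def by (rule minus_carrier_mat[OF hDc])
    have "D (Suc i) * M = C i * D (Suc i) - C i * D (Suc i)"
      unfolding M_def using mult_minus_distrib_mat[OF Dc C hDc] chain hD by simp
    also have "\<dots> = 0\<^sub>m (length (s i)) (length (s (Suc i)))"
      using C[of i] Dc[of i] by (intro minus_r_inv_mat) auto
    finally have z: "D (Suc i) * M = 0\<^sub>m (length (s i)) (length (s (Suc i)))" .
    obtain h' where h': "h' \<in> carrier_mat (length (s (Suc (Suc i)))) (length (s (Suc i)))"
      and Dh': "D (Suc (Suc i)) * h' = M"
      using factor_through_image[OF M Dc col_in_kernel_image[OF R M z]] by blast
    have "D (Suc (Suc i)) * (h' * D (Suc (Suc i))) = M * D (Suc (Suc i))"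
      using assoc_mult_mat[OF Dc h' Dc] Dh' by simp
    also have "\<dots> = C (Suc i) * D (Suc (Suc i)) - h * D (Suc i) * D (Suc (Suc i))"
      unfolding M_def by (rule minus_mult_distrib_mat[OF C hDc Dc])
    also have "h * D (Suc i) * D (Suc (Suc i)) = h * (D (Suc i) * D (Suc (Suc i)))"
      by (rule assoc_mult_mat[OF h Dc Dc])
    also have "\<dots> = 0\<^sub>m (length (s (Suc i))) (length (s (Suc (Suc i))))"
      using resolution_complex_Suc[OF R] h by simp
    also have "C (Suc i) * D (Suc (Suc i)) - \<dots> = C (Suc i) * D (Suc (Suc i))"
      using C[of "Suc i"] Dc[of "Suc i"] by auto
    finally have 1: "D (Suc (Suc i)) * (h' * D (Suc (Suc i))) = C (Suc i) * D (Suc (Suc i))" .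
    have "coef (C (Suc i) $$ (r, c)) 0 = 0"
      if rc: "r < length (s (Suc i))" "c < length (s (Suc i))" for r c
    proof -
      have "C (Suc i) $$ (r, c) = M $$ (r, c) + (h * D (Suc i)) $$ (r, c)"
        unfolding M_def using minus_mat_entry[OF C hDc rc] by simp
      moreover have "coef (M $$ (r, c)) 0 = 0"
        using const_coef_mat_mult[OF Dc h' rc] Dh' m[of r "Suc i"] rc by simp
      moreover have "coef ((h * D (Suc i)) $$ (r, c)) 0 = 0"
        using const_coef_mat_mult[OF h Dc rc] m[of _ i c] rc by simp
      ultimately show ?thesis by (simp add: lookup_add)
    qed
    with h' 1 show ?case by blast
  qed
  then show ?thesis using rc by blast
qed

text \<open>A matrix over a field with a left inverse has independent columns.\<close>

lemma left_inverse_card_le: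
  fixes a :: "nat \<Rightarrow> 'i \<Rightarrow> 'k::field"
  assumes "finite X" "finite Y"
    and inv: "\<And>c c'. c \<in> X \<Longrightarrow> c' \<in> X \<Longrightarrow> (\<Sum>k\<in>Y. b c k * a k c') = (if c = c' then 1 else 0)"
  shows "card X \<le> card Y"
proof -
  define f where "f c = (\<Sum>k\<in>Y. Poly_Mapping.single k (a k c))" for c
  have "indep_family X f"
    unfolding indep_family_def
  proof (intro allI impI ballI)
    fix g c assume z: "(\<Sum>c\<in>X. Poly_Mapping.single 0 (g c) * f c) = 0" and c: "c \<in> X"
    have "(\<Sum>c'\<in>X. g c' * a k c') = 0" if k: "k \<in> Y" for k
    proof -
      have "Poly_Mapping.lookup (\<Sum>c\<in>X. Poly_Mapping.single 0 (g c) * f c) k = (\<Sum>c'\<in>X. g c' * a k c')"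
        using k \<open>finite Y\<close>
        by (simp add: lookup_sum f_def sum_distrib_left mult_single lookup_single when_def sum.delta)
      then show ?thesis using z by simp
    qed
    then have "0 = (\<Sum>k\<in>Y. b c k * (\<Sum>c'\<in>X. g c' * a k c'))" by simp
    also have "\<dots> = (\<Sum>c'\<in>X. \<Sum>k\<in>Y. b c k * (g c' * a k c'))"
      by (simp add: sum_distrib_left) (rule sum.swap)
    also have "\<dots> = (\<Sum>c'\<in>X. g c' * (\<Sum>k\<in>Y. b c k * a k c'))"
      unfolding sum_distrib_left by (intro sum.cong refl mult.left_commute)
    also have "\<dots> = (\<Sum>c'\<in>X. if c = c' then g c' else 0)"
      using inv[OF c] by (intro sum.cong) auto
    also have "\<dots> = g c" using \<open>finite X\<close> c by simp
    finally show "g c = 0" by simp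
  qed
  moreover have "f ` X \<subseteq> kvs.span ((\<lambda>k. Poly_Mapping.single k 1) ` Y)"
  proof (intro image_subsetI span_monomials)
    fix c show "Poly_Mapping.keys (f c) \<subseteq> Y"
      unfolding f_def using keys_sum[of "\<lambda>k. Poly_Mapping.single k (a k c)" Y] by (fastforce split: if_splits)
  qed
  ultimately have "card X \<le> card ((\<lambda>k. Poly_Mapping.single k (1::'k)) ` Y)"
    using assms(1,2) by (intro indep_family_card_le) auto
  also have "\<dots> \<le> card Y" using assms(2) by (rule card_image_le)
  finally show ?thesis .
qed

lemma count_list_nth: "count_list xs x = card {i. i < length xs \<and> xs ! i = x}"
  by (simp add: count_list_eq_length_filter length_filter_conv_card eq_commute)

text \<open>The composite of comparison maps to any other resolution and back differs from the
identity by a nullhomotopic map, so modulo the variables the map has a left inverse. Being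
graded, its matrix of constants only connects equal twists, which yields the inequality twist
by twist.\<close>

proposition minimal_resolution_count_le:
  fixes D E :: "nat \<Rightarrow> ('v::finite, 'k::field) mpoly mat"
  assumes min: "minimal_free_resolution I s D" and S: "graded_free_resolution I t E"
    and I: "ideals.subspace I" and hI: "\<And>e p. p \<in> I \<Longrightarrow> hom_component e p \<in> I"
  shows "count_list (s i) j \<le> count_list (t i) j"
proof -
  have R: "graded_free_resolution I s D" using min by (simp add: minimal_free_resolution_def)
  note D0 = resolution_carrier_0[OF R] and E0 = resolution_carrier_0[OF S]
  note Dc = resolution_carrier_Suc[OF R] and Ec = resolution_carrier_Suc[OF S]
  obtain A where A: "\<And>i. homog_mat (t i) (s i) (A i)"
    and A0: "\<And>c. c < length (s 0) \<Longrightarrow> (D 0 - E 0 * A 0) $$ (0, c) \<in> I"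
    and AS: "\<And>i. E (Suc i) * A (Suc i) = A i * D (Suc i)"
    using comparison_map_exists[OF R S I hI] by blast
  obtain B where B: "\<And>i. homog_mat (s i) (t i) (B i)"
    and B0: "\<And>c. c < length (t 0) \<Longrightarrow> (E 0 - D 0 * B 0) $$ (0, c) \<in> I"
    and BS: "\<And>i. D (Suc i) * B (Suc i) = B i * E (Suc i)"
    using comparison_map_exists[OF S R I hI] by blast
  have Ac: "A i \<in> carrier_mat (length (t i)) (length (s i))" for i
    using A by (simp add: homog_mat_def)
  have Bc: "B i \<in> carrier_mat (length (s i)) (length (t i))" for i
    using B by (simp add: homog_mat_def)
  have BA: "B i * A i \<in> carrier_mat (length (s i)) (length (s i))" for i
    using Ac Bc by (rule mult_carrier_mat[rotated])
  \<comment> \<open>The composite minus the identity induces zero on \<open>R/I\<close>.\<close>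
  define C where "C i = B i * A i - 1\<^sub>m (length (s i))" for i
  have C: "C i \<in> carrier_mat (length (s i)) (length (s i))" for i
    unfolding C_def by (rule minus_carrier_mat) simp
  have aug: "(D 0 * C 0) $$ (0, c) \<in> I" if c: "c < length (s 0)" for c
  proof -
    have one: "1\<^sub>m (length (s 0)) \<in> carrier_mat (length (s 0)) (length (s 0))" by simp
    have DB: "D 0 * B 0 \<in> carrier_mat 1 (length (t 0))" and EA: "E 0 * A 0 \<in> carrier_mat 1 (length (s 0))"
      using D0 E0 Ac Bc by (auto intro: mult_carrier_mat)
    have DBA: "D 0 * B 0 * A 0 \<in> carrier_mat 1 (length (s 0))" using DB Ac by (rule mult_carrier_mat)
    have "D 0 * C 0 = D 0 * B 0 * A 0 - D 0"
      unfolding C_def mult_minus_distrib_mat[OF D0 BA one] assoc_mult_mat[OF D0 Bc Ac]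
      using D0 by simp
    then have "(D 0 * C 0) $$ (0, c) = (D 0 * B 0 * A 0) $$ (0, c) - D 0 $$ (0, c)"
      using minus_mat_entry[OF DBA D0 _ c, of 0] by simp
    also have "\<dots> = - (((E 0 - D 0 * B 0) * A 0) $$ (0, c)) - (D 0 - E 0 * A 0) $$ (0, c)"
      using minus_mat_entry[OF EA DBA _ c, of 0] minus_mat_entry[OF D0 EA _ c, of 0]
      by (simp add: minus_mult_distrib_mat[OF E0 DB Ac])
    also have "((E 0 - D 0 * B 0) * A 0) $$ (0, c) = ((E 0 - D 0 * B 0) *\<^sub>v col (A 0) c) $ 0"
      using E0 DB Ac[of 0] c by auto
    also have "- \<dots> - (D 0 - E 0 * A 0) $$ (0, c) \<in> I"
    proof (intro ideals.subspace_diff[OF I] ideals.subspace_neg[OF I] A0 c)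
      show "((E 0 - D 0 * B 0) *\<^sub>v col (A 0) c) $ 0 \<in> I"
        using Ac[of 0] c by (intro combination_in_ideal[OF I minus_carrier_mat[OF DB] B0]) auto
    qed
    finally show ?thesis .
  qed
  have chain: "D (Suc i) * C (Suc i) = C i * D (Suc i)" for i
  proof -
    have "D (Suc i) * C (Suc i) = D (Suc i) * B (Suc i) * A (Suc i) - D (Suc i)"
      unfolding C_def mult_minus_distrib_mat[OF Dc BA one_carrier_mat] assoc_mult_mat[OF Dc Bc Ac]
      using Dc[of i] by simp
    also have "D (Suc i) * B (Suc i) * A (Suc i) = B i * A i * D (Suc i)"
      unfolding BS assoc_mult_mat[OF Bc Ec Ac] AS assoc_mult_mat[OF Bc Ac Dc] ..
    also have "\<dots> - D (Suc i) = C i * D (Suc i)"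
      unfolding C_def minus_mult_distrib_mat[OF BA one_carrier_mat Dc] using Dc[of i] by simp
    finally show ?thesis .
  qed
  have const: "(\<Sum>k<length (t i). coef (B i $$ (c, k)) 0 * coef (A i $$ (k, c')) 0)
      = (if c = c' then 1 else 0)" if cc: "c < length (s i)" "c' < length (s i)" for c c'
  proof -
    have "(B i * A i) $$ (c, c') = C i $$ (c, c') + 1\<^sub>m (length (s i)) $$ (c, c')"
      unfolding C_def using minus_mat_entry[OF BA one_carrier_mat cc] by simp
    then have "coef ((B i * A i) $$ (c, c')) 0 = (if c = c' then 1 else 0)"
      using nullhomotopic_const_coef[where C = C and D = D and i = i, OF min C aug chain cc] cc by (simp add: lookup_add)
    then show ?thesis using const_coef_mat_mult[OF Bc Ac cc] by simp
  qed
  have deg: "s i ! c = t i ! k"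
    if "coef (A i $$ (k, c)) 0 \<noteq> 0" "k < length (t i)" "c < length (s i)" for k c
  proof -
    have "homogeneous (s i ! c - t i ! k) (A i $$ (k, c))"
      using A[of i] that(2,3) by (simp add: homog_mat_def)
    from homogeneous_coef_0[OF this that(1)] show ?thesis by simp
  qed
  have "card {c. c < length (s i) \<and> s i ! c = j} \<le> card {k. k < length (t i) \<and> t i ! k = j}"
  proof (rule left_inverse_card_le[where a = "\<lambda>k c. coef (A i $$ (k, c)) 0"
        and b = "\<lambda>c k. coef (B i $$ (c, k)) 0"])
    fix c c' assume c: "c \<in> {c. c < length (s i) \<and> s i ! c = j}"
      and c': "c' \<in> {c. c < length (s i) \<and> s i ! c = j}"
    have "(\<Sum>k\<in>{k. k < length (t i) \<and> t i ! k = j}. coef (B i $$ (c, k)) 0 * coef (A i $$ (k, c')) 0)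
        = (\<Sum>k<length (t i). coef (B i $$ (c, k)) 0 * coef (A i $$ (k, c')) 0)"
      using deg c' by (intro sum.mono_neutral_left) auto
    also have "\<dots> = (if c = c' then 1 else 0)" using const c c' by simp
    finally show "(\<Sum>k\<in>{k. k < length (t i) \<and> t i ! k = j}.
        coef (B i $$ (c, k)) 0 * coef (A i $$ (k, c')) 0) = (if c = c' then 1 else 0)" .
  qed auto
  then show ?thesis by (simp add: count_list_nth)
qed

proposition graded_betti_eq_count:
  assumes min: "minimal_free_resolution I s D"
    and I: "ideals.subspace I" and hI: "\<And>e p. p \<in> I \<Longrightarrow> hom_component e p \<in> I"
  shows "graded_betti I i j = count_list (s i) j"
  unfolding graded_betti_def
proof (rule the_equality)
  show "\<exists>s' D'. minimal_free_resolution I s' D' \<and> count_list (s i) j = count_list (s' i) j"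
    using min by blast
next
  fix b assume "\<exists>s' D'. minimal_free_resolution I s' D' \<and> b = count_list (s' i) j"
  then obtain s' D' where s': "minimal_free_resolution I s' D'" "b = count_list (s' i) j" by blast
  show "b = count_list (s i) j"
    using minimal_resolution_count_le[OF min _ I hI, of s' D']
      minimal_resolution_count_le[OF s'(1) _ I hI, of s D] s' min
    by (simp add: minimal_free_resolution_def le_antisym)
qed

section \<open>Krull dimension by counting monomials\<close>

lemma prime_idealD:
  assumes "prime_ideal P"
  shows "ideals.subspace P" "1 \<notin> P" "a * b \<in> P \<Longrightarrow> a \<in> P \<or> b \<in> P"
proof -
  show s: "ideals.subspace P" using assms by (simp add: prime_ideal_def)
  have "P \<noteq> UNIV" using assms by (simp add: prime_ideal_def)
  then show "1 \<notin> P" using ideals.subspace_scale[OF s, of 1] by auto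
  show "a * b \<in> P \<Longrightarrow> a \<in> P \<or> b \<in> P" using assms by (simp add: prime_ideal_def)
qed

lemma prime_ideal_power:
  assumes "prime_ideal P" "a \<notin> P"
  shows "a ^ n \<notin> P"
  by (induction n) (use assms prime_idealD[OF assms(1)] in auto)

lemma prime_ideal_constant:
  assumes "prime_ideal P" "Poly_Mapping.single 0 c \<in> P"
  shows "c = 0"
proof (rule ccontr)
  assume "c \<noteq> 0"
  then have "Poly_Mapping.single 0 (inverse c) * Poly_Mapping.single 0 c = 1"
    by (simp add: mult_single)
  then have "1 \<in> P"
    using ideals.subspace_scale[OF prime_idealD(1)[OF assms(1)] assms(2)] by metis
  then show False using prime_idealD(2)[OF assms(1)] by blast
qed

text \<open>Elements \<open>f\<^sub>i\<close> that witness the strictness of a chain of primes are algebraically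
independent modulo its first member. In a relation, divide by the least power of \<open>f\<^sub>j\<close> that occurs;
this is allowed since \<open>f\<^sub>j \<notin> P\<^sub>j\<close>. Modulo \<open>P\<^sub>j\<^sub>+\<^sub>1\<close>, which contains \<open>f\<^sub>j\<close>, only the terms that attain this
least power survive, and they form a relation between the later \<open>f\<^sub>i\<close>. The set \<open>A\<close> of exponent
functions is arbitrary apart from being determined by the exponents still in use, so that it can
shrink during the induction.\<close>

lemma prime_chain_power_products_independent:
  fixes P :: "nat \<Rightarrow> ('v, 'k::field) mpoly set" and f :: "nat \<Rightarrow> ('v, 'k) mpoly"
  assumes prime: "\<And>i. i \<le> l \<Longrightarrow> prime_ideal (P i)"
    and sub: "\<And>i. i < l \<Longrightarrow> P i \<subseteq> P (Suc i)"
    and f: "\<And>i. i < l \<Longrightarrow> f i \<in> P (Suc i)" "\<And>i. i < l \<Longrightarrow> f i \<notin> P i"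
    and "j \<le> l" "finite A"
    and "\<And>a b. a \<in> A \<Longrightarrow> b \<in> A \<Longrightarrow> (\<And>i. i \<in> {j..<l} \<Longrightarrow> a i = b i) \<Longrightarrow> a = b"
    and "(\<Sum>a\<in>A. Poly_Mapping.single 0 (c a) * (\<Prod>i\<in>{j..<l}. f i ^ a i)) \<in> P j"
    and "a \<in> A"
  shows "c a = 0"
  using assms(5-9)
proof (induction arbitrary: A a rule: inc_induct)
  case base
  have "A = {a}" using base.prems by auto
  then have "Poly_Mapping.single 0 (c a) \<in> P l" using base.prems(3) by simp
  then show ?case by (rule prime_ideal_constant[OF prime[OF order_refl]])
next
  case (step j)
  have j: "j < l" "j \<le> l" "Suc j \<le> l" using step.hyps by auto
  note Pj = prime_idealD[OF prime[OF j(2)]] and PSj = prime_idealD[OF prime[OF j(3)]]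
  define A' where "A' = {a \<in> A. c a \<noteq> 0}"
  show ?case
  proof (rule ccontr)
    assume "c a \<noteq> 0"
    then have A': "finite A'" "a \<in> A'" "A' \<subseteq> A" using step.prems by (auto simp: A'_def)
    \<comment> \<open>The least power of \<open>f j\<close> with a nonzero coefficient.\<close>
    define \<alpha> where "\<alpha> = Min ((\<lambda>a. a j) ` A')"
    have le: "\<alpha> \<le> b j" if "b \<in> A'" for b
      unfolding \<alpha>_def using A' that by (intro Min_le) auto
    have "\<alpha> \<in> (\<lambda>a. a j) ` A'" unfolding \<alpha>_def using A' by (intro Min_in) auto
    then obtain b where b: "b \<in> A'" "b j = \<alpha>" by auto
    define G where "G a = Poly_Mapping.single 0 (c a) * (\<Prod>i\<in>{Suc j..<l}. f i ^ a i)" for a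
    have split: "(\<Prod>i\<in>{j..<l}. f i ^ a i) = f j ^ a j * (\<Prod>i\<in>{Suc j..<l}. f i ^ a i)" for a
      using j by (simp add: prod.atLeast_Suc_lessThan)
    have "(\<Sum>a\<in>A. Poly_Mapping.single 0 (c a) * (\<Prod>i\<in>{j..<l}. f i ^ a i))
        = (\<Sum>a\<in>A'. Poly_Mapping.single 0 (c a) * (\<Prod>i\<in>{j..<l}. f i ^ a i))"
      using step.prems(1) by (intro sum.mono_neutral_right) (auto simp: A'_def)
    also have "\<dots> = (\<Sum>a\<in>A'. f j ^ \<alpha> * (f j ^ (a j - \<alpha>) * G a))"
    proof (rule sum.cong[OF refl])
      fix a assume "a \<in> A'"
      then have "f j ^ a j = f j ^ \<alpha> * f j ^ (a j - \<alpha>)" using le by (simp flip: power_add)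
      then show "Poly_Mapping.single 0 (c a) * (\<Prod>i\<in>{j..<l}. f i ^ a i)
          = f j ^ \<alpha> * (f j ^ (a j - \<alpha>) * G a)" by (simp add: split G_def ac_simps)
    qed
    also have "\<dots> = f j ^ \<alpha> * (\<Sum>a\<in>A'. f j ^ (a j - \<alpha>) * G a)"
      by (simp add: sum_distrib_left)
    finally have "f j ^ \<alpha> * (\<Sum>a\<in>A'. f j ^ (a j - \<alpha>) * G a) \<in> P j"
      using step.prems(3) by simp
    then have "(\<Sum>a\<in>A'. f j ^ (a j - \<alpha>) * G a) \<in> P j"
      using Pj(3) prime_ideal_power[OF prime[OF j(2)] f(2)[OF j(1)]] by blast
    then have tot: "(\<Sum>a\<in>A'. f j ^ (a j - \<alpha>) * G a) \<in> P (Suc j)" using sub[OF j(1)] by blast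
    define A1 where "A1 = {a \<in> A'. a j = \<alpha>}"
    \<comment> \<open>The terms with a higher power of \<open>f j\<close> vanish modulo \<open>P (Suc j)\<close>.\<close>
    have rest: "(\<Sum>a\<in>A' - A1. f j ^ (a j - \<alpha>) * G a) \<in> P (Suc j)"
    proof (rule ideals.subspace_sum[OF PSj(1)])
      fix a assume "a \<in> A' - A1"
      then have "a j - \<alpha> \<noteq> 0" using le[of a] by (auto simp: A1_def)
      then have "f j ^ (a j - \<alpha>) * G a = (f j ^ (a j - \<alpha> - 1) * G a) * f j"
        by (cases "a j - \<alpha>") (auto simp: ac_simps)
      then show "f j ^ (a j - \<alpha>) * G a \<in> P (Suc j)"
        using ideals.subspace_scale[OF PSj(1) f(1)[OF j(1)]] by simp
    qed
    have "(\<Sum>a\<in>A'. f j ^ (a j - \<alpha>) * G a)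
        = (\<Sum>a\<in>A' - A1. f j ^ (a j - \<alpha>) * G a) + (\<Sum>a\<in>A1. f j ^ (a j - \<alpha>) * G a)"
      using A'(1) by (intro sum.subset_diff) (auto simp: A1_def)
    then have "(\<Sum>a\<in>A1. f j ^ (a j - \<alpha>) * G a) \<in> P (Suc j)"
      using ideals.subspace_diff[OF PSj(1) tot rest] by simp
    moreover have "(\<Sum>a\<in>A1. f j ^ (a j - \<alpha>) * G a)
        = (\<Sum>a\<in>A1. Poly_Mapping.single 0 (c a) * (\<Prod>i\<in>{Suc j..<l}. f i ^ a i))"
      by (intro sum.cong refl) (simp add: A1_def G_def)
    ultimately have "(\<Sum>a\<in>A1. Poly_Mapping.single 0 (c a) * (\<Prod>i\<in>{Suc j..<l}. f i ^ a i)) \<in> P (Suc j)"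
      by simp
    moreover have "x = y" if "x \<in> A1" "y \<in> A1" "\<And>i. i \<in> {Suc j..<l} \<Longrightarrow> x i = y i" for x y
    proof (rule step.prems(2))
      show "x \<in> A" "y \<in> A" using that A' by (auto simp: A1_def)
      fix i assume "i \<in> {j..<l}"
      then show "x i = y i" using that by (cases "i = j") (auto simp: A1_def)
    qed
    moreover have "finite A1" "b \<in> A1" using A'(1) b by (auto simp: A1_def)
    ultimately have "c b = 0" using step.IH[of A1 b] by blast
    then show False using b by (simp add: A'_def)
  qed
qed

lift_definition kill_vars :: "'v set \<Rightarrow> ('v, 'k::field) mpoly \<Rightarrow> ('v, 'k) mpoly" is
  "\<lambda>S p m. p m when supp m \<inter> S = {}"
  by (rule finite_subset[rotated]) auto

lemma coef_kill_vars: "coef (kill_vars S p) m = (coef p m when supp m \<inter> S = {})"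
  by (simp add: kill_vars.rep_eq)

lemma kill_vars_linear:
  fixes g :: "'i \<Rightarrow> ('v, 'k::field) mpoly"
  shows "kill_vars S (\<Sum>a\<in>A. Poly_Mapping.single 0 (c a) * g a)
     = (\<Sum>a\<in>A. Poly_Mapping.single 0 (c a) * kill_vars S (g a))"
proof (rule poly_mapping_eqI)
  fix m
  have *: "coef (Poly_Mapping.single 0 d * p) m = d * coef p m" for d and p :: "('v, 'k) mpoly"
    using coef_single_mult_shift[of 0 d p m] by simp
  show "coef (kill_vars S (\<Sum>a\<in>A. Poly_Mapping.single 0 (c a) * g a)) m
     = coef (\<Sum>a\<in>A. Poly_Mapping.single 0 (c a) * kill_vars S (g a)) m"
    by (simp add: coef_kill_vars lookup_sum * when_def)
qed

lemma single_in_ideal_of_var: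
  assumes P: "ideals.subspace P" and v: "var v \<in> P" and m: "v \<in> supp m"
  shows "Poly_Mapping.single m c \<in> P"
proof -
  have "m = (m - Poly_Mapping.single v 1) + Poly_Mapping.single v 1"
    using m by (intro poly_mapping_eqI)
      (auto simp: lookup_add lookup_minus lookup_single when_def in_keys_iff)
  then have "Poly_Mapping.single m c = Poly_Mapping.single (m - Poly_Mapping.single v 1) c * var v"
    by (simp add: var_def mult_single)
  then show ?thesis using ideals.subspace_scale[OF P v] by simp
qed

lemma diff_kill_vars_in_ideal:
  assumes P: "ideals.subspace P" and S: "var ` S \<subseteq> P"
  shows "p - kill_vars S p \<in> P"
proof -
  have "p - kill_vars S p = (\<Sum>m\<in>mons (p - kill_vars S p). Poly_Mapping.single m (coef (p - kill_vars S p) m))"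
    by (rule mpoly_expand)
  also have "\<dots> \<in> P"
  proof (rule ideals.subspace_sum[OF P])
    fix m assume "m \<in> mons (p - kill_vars S p)"
    then obtain v where "v \<in> supp m" "v \<in> S"
      by (auto simp: in_keys_iff lookup_minus coef_kill_vars when_def split: if_splits)
    then show "Poly_Mapping.single m (coef (p - kill_vars S p) m) \<in> P"
      using S by (intro single_in_ideal_of_var[OF P]) auto
  qed
  finally show ?thesis .
qed

definition expo_bounded :: "nat \<Rightarrow> ('v, 'k::field) mpoly \<Rightarrow> bool" where
  "expo_bounded d p \<longleftrightarrow> (\<forall>m\<in>mons p. \<forall>v. expo m v \<le> d)"

lemma expo_bounded_exists: "\<exists>d. expo_bounded d (p :: ('v::finite, 'k::field) mpoly)"
proof -
  have "expo_bounded (\<Sum>m\<in>mons p. \<Sum>v\<in>UNIV. expo m v) p"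
    unfolding expo_bounded_def
  proof (intro ballI allI)
    fix m v assume m: "m \<in> mons p"
    have "expo m v \<le> (\<Sum>v\<in>UNIV. expo m v)" by (rule member_le_sum) auto
    also have "\<dots> \<le> (\<Sum>m\<in>mons p. \<Sum>v\<in>UNIV. expo m v)"
      using m by (intro member_le_sum[of m]) auto
    finally show "expo m v \<le> (\<Sum>m\<in>mons p. \<Sum>v\<in>UNIV. expo m v)" .
  qed
  then show ?thesis by blast
qed

lemma expo_bounded_mult: "expo_bounded d p \<Longrightarrow> expo_bounded e q \<Longrightarrow> expo_bounded (d + e) (p * q)"
  using keys_mult[of p q] unfolding expo_bounded_def by (fastforce simp: lookup_add add_mono)

lemma expo_bounded_power: "expo_bounded d p \<Longrightarrow> expo_bounded (n * d) (p ^ n)"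
  by (induction n) (auto intro: expo_bounded_mult simp: expo_bounded_def[of 0])

lemma expo_bounded_prod:
  "finite A \<Longrightarrow> (\<And>i. i \<in> A \<Longrightarrow> expo_bounded (d i) (p i)) \<Longrightarrow> expo_bounded (sum d A) (prod p A)"
  by (induction A rule: finite_induct) (auto intro: expo_bounded_mult simp: expo_bounded_def[of 0])

lemma expo_bounded_mono: "expo_bounded d p \<Longrightarrow> d \<le> e \<Longrightarrow> expo_bounded e p"
  unfolding expo_bounded_def by (meson le_trans)

lemma card_bounded_monomials:
  fixes S :: "'v::finite set" and d :: nat
  defines "B \<equiv> {m :: 'v \<Rightarrow>\<^sub>0 nat. supp m \<inter> S = {} \<and> (\<forall>v. expo m v \<le> d)}"
  shows "finite B" "card B \<le> (d + 1) ^ card (- S)"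
proof -
  let ?F = "PiE (- S) (\<lambda>_. {..d})"
  define r where "r m = restrict (expo m) (- S)" for m
  have r: "inj_on r B" "r ` B \<subseteq> ?F"
  proof (rule inj_onI)
    fix m k assume mk: "m \<in> B" "k \<in> B" "r m = r k"
    have "expo m v = expo k v" for v
    proof (cases "v \<in> S")
      case True
      then have "v \<notin> supp m" "v \<notin> supp k" using mk by (auto simp: B_def)
      then show ?thesis by (simp add: in_keys_iff)
    next
      case False
      then show ?thesis using fun_cong[OF mk(3), of v] by (simp add: r_def)
    qed
    then show "m = k" by (rule poly_mapping_eqI)
  qed (auto simp: r_def B_def)
  have F: "finite ?F" by (intro finite_PiE) auto
  show "finite B" using inj_on_finite[OF r F] .
  show "card B \<le> (d + 1) ^ card (- S)"
    using card_inj_on_le[OF r F] by (simp add: card_PiE)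
qed

text \<open>The \<open>(T + 1)\<^sup>l\<close> power products with exponents at most \<open>T\<close> are independent modulo \<open>P\<^sub>0\<close>, hence stay
independent when the variables in \<open>S\<close> are set to zero. They then live in the span of the
monomials in the remaining variables with exponents bounded by a multiple of \<open>T\<close>, whose number
grows like \<open>T\<close> to the power of the number of these variables.\<close>

proposition prime_chain_length_le:
  fixes P :: "nat \<Rightarrow> ('v::finite, 'k::field) mpoly set"
  assumes prime: "\<And>i. i \<le> l \<Longrightarrow> prime_ideal (P i)"
    and sub: "\<And>i. i < l \<Longrightarrow> P i \<subset> P (Suc i)"
    and S: "var ` S \<subseteq> P 0"
  shows "l \<le> card (- S)"
proof (rule ccontr)
  assume "\<not> l \<le> card (- S)"
  then have lt: "card (- S) < l" by simp
  have "\<forall>i. \<exists>p. i < l \<longrightarrow> p \<in> P (Suc i) \<and> p \<notin> P i" using sub by blast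
  then obtain f where f: "\<And>i. i < l \<Longrightarrow> f i \<in> P (Suc i)" "\<And>i. i < l \<Longrightarrow> f i \<notin> P i" by metis
  have P0: "ideals.subspace (P 0)" using prime_idealD(1)[OF prime] by simp
  have "\<forall>i. \<exists>d. expo_bounded d (f i)" by (intro allI expo_bounded_exists)
  then obtain e0 where e0: "\<And>i. expo_bounded (e0 i) (f i)" by metis
  define e where "e = (\<Sum>i<l. e0 i)"
  have e: "expo_bounded e (f i)" if "i < l" for i
    using that by (intro expo_bounded_mono[OF e0]) (auto simp: e_def intro!: member_le_sum)
  define K where "K = l * e + 1"
  have main: "(T + 1) ^ l \<le> (l * (T * e) + 1) ^ card (- S)" for T
  proof -
    define A where "A = PiE {0..<l} (\<lambda>_. {..T})"
    define F where "F a = (\<Prod>i\<in>{0..<l}. f i ^ a i)" for a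
    define B where "B = {m :: 'v \<Rightarrow>\<^sub>0 nat. supp m \<inter> S = {} \<and> (\<forall>v. expo m v \<le> l * (T * e))}"
    have B: "finite B" "card B \<le> (l * (T * e) + 1) ^ card (- S)"
      unfolding B_def by (rule card_bounded_monomials)+
    have A: "finite A" unfolding A_def by (intro finite_PiE) auto
    have "indep_family A (\<lambda>a. kill_vars S (F a))"
      unfolding indep_family_def
    proof (intro allI impI ballI)
      fix c a
      assume z: "(\<Sum>a\<in>A. Poly_Mapping.single 0 (c a) * kill_vars S (F a)) = 0" and a: "a \<in> A"
      have "(\<Sum>a\<in>A. Poly_Mapping.single 0 (c a) * F a) \<in> P 0"
        using diff_kill_vars_in_ideal[OF P0 S, of "\<Sum>a\<in>A. Poly_Mapping.single 0 (c a) * F a"] z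
        by (simp add: kill_vars_linear)
      then have mem: "(\<Sum>a\<in>A. Poly_Mapping.single 0 (c a) * (\<Prod>i\<in>{0..<l}. f i ^ a i)) \<in> P 0"
        by (simp add: F_def)
      \<comment> \<open>Members of \<open>A\<close> agree outside \<open>{0..<l}\<close> by extensionality.\<close>
      have eq: "x = y" if "x \<in> A" "y \<in> A" "\<And>i. i \<in> {0..<l} \<Longrightarrow> x i = y i" for x y
        using that unfolding A_def by (rule PiE_ext)
      show "c a = 0"
        by (rule prime_chain_power_products_independent[where P = P and l = l and f = f and j = 0
              and A = A and c = c and a = a, OF prime psubset_imp_subset[OF sub] f _ A eq mem a]) simp_all
    qed
    moreover have "(\<lambda>a. kill_vars S (F a)) ` A \<subseteq> kvs.span ((\<lambda>m. Poly_Mapping.single m 1) ` B)"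
    proof (intro image_subsetI span_monomials subsetI)
      fix a m assume a: "a \<in> A" and m: "m \<in> mons (kill_vars S (F a))"
      have "expo_bounded (\<Sum>i\<in>{0..<l}. a i * e) (F a)"
        unfolding F_def using e by (intro expo_bounded_prod expo_bounded_power) auto
      moreover have "(\<Sum>i\<in>{0..<l}. a i * e) \<le> (\<Sum>i\<in>{0..<l}. T * e)"
        using a by (intro sum_mono mult_right_mono) (auto simp: A_def)
      ultimately have "expo_bounded (l * (T * e)) (F a)" by (auto intro: expo_bounded_mono)
      then show "m \<in> B" using m
        by (auto simp: B_def expo_bounded_def in_keys_iff coef_kill_vars when_def split: if_splits)
    qed
    ultimately have "card A \<le> card ((\<lambda>m. Poly_Mapping.single m (1::'k)) ` B)"
      using A B by (intro indep_family_card_le) auto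
    also have "\<dots> \<le> card B" using B(1) by (rule card_image_le)
    finally show ?thesis using B(2) by (simp add: A_def card_PiE)
  qed
  let ?k = "card (- S)"
  \<comment> \<open>With \<open>l > k\<close> the estimate gives \<open>T + 1 \<le> K ^ k\<close>, which fails for this \<open>T\<close>.\<close>
  define T where "T = K ^ ?k"
  have "(T + 1) ^ ?k * (T + 1) \<le> (T + 1) ^ l"
    using lt power_increasing[of "Suc ?k" l "T + 1"] by (simp add: mult.commute)
  also have "\<dots> \<le> (l * (T * e) + 1) ^ ?k" by (rule main)
  also have "\<dots> \<le> ((T + 1) * K) ^ ?k"
    by (intro power_mono) (auto simp: K_def algebra_simps)
  also have "\<dots> = (T + 1) ^ ?k * T" by (simp only: power_mult_distrib T_def)
  finally show False by simp
qed

text \<open>Exponent vectors over an arbitrary finite type carry no linear order. Renaming the variables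
by numbers embeds them additively into \<open>nat \<Rightarrow>\<^sub>0 nat\<close>, whose lexicographic order is compatible with
addition.\<close>

definition expo_key :: "('v::finite \<Rightarrow>\<^sub>0 nat) \<Rightarrow> (nat \<Rightarrow>\<^sub>0 nat)" where
  "expo_key m = (\<Sum>v\<in>UNIV. Poly_Mapping.single (to_nat v) (expo m v))"

lemma expo_key_add: "expo_key (a + b) = expo_key a + expo_key b"
  by (simp add: expo_key_def lookup_add single_add sum.distrib)

lemma expo_key_inject: "expo_key a = expo_key b \<longleftrightarrow> a = b"
proof
  assume eq: "expo_key a = expo_key b"
  have *: "Poly_Mapping.lookup (expo_key m) (to_nat v) = expo m v" for m :: "'a \<Rightarrow>\<^sub>0 nat" and v
    by (simp add: expo_key_def lookup_sum lookup_single when_def)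
  show "a = b" by (rule poly_mapping_eqI) (metis * eq)
qed simp

text \<open>The ideal generated by the variables in \<open>S\<close>.\<close>

definition var_ideal :: "'v set \<Rightarrow> ('v, 'k::field) mpoly set" where
  "var_ideal S = monomial_ideal {m. supp m \<inter> S \<noteq> {}}"

lemma supp_add: "supp (a + b) = supp a \<union> supp (b :: 'v \<Rightarrow>\<^sub>0 nat)"
  by (auto simp: in_keys_iff lookup_add)

lemma var_ideal_subspace: "ideals.subspace (var_ideal S)"
  unfolding var_ideal_def by (rule monomial_ideal_subspace) (auto simp: supp_add)

lemma leading_monomial_outside:
  assumes "a \<notin> var_ideal (S :: 'v::finite set)"
  obtains m where "m \<in> mons a" "supp m \<inter> S = {}"
    "\<And>k. k \<in> mons a \<Longrightarrow> supp k \<inter> S = {} \<Longrightarrow> expo_key k \<le> expo_key m"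
proof -
  define M where "M = {m \<in> mons a. supp m \<inter> S = {}}"
  have M: "finite (expo_key ` M)" "expo_key ` M \<noteq> {}"
    using assms by (auto simp: M_def var_ideal_def monomial_ideal_def)
  obtain m where m: "m \<in> M" "expo_key m = Max (expo_key ` M)" using Max_in[OF M] by auto
  have "expo_key k \<le> expo_key m" if "k \<in> M" for k using m(2) Max_ge[OF M(1)] that by simp
  then show ?thesis using m(1) by (intro that[of m]) (auto simp: M_def)
qed

text \<open>Among the monomials outside the ideal, the largest one of \<open>a\<close> and the largest one of \<open>b\<close> have
a product that cannot cancel in \<open>a * b\<close>, and it lies outside the ideal again.\<close>

lemma var_ideal_prime:
  fixes S :: "'v::finite set"
  shows "prime_ideal (var_ideal S :: ('v, 'k::field) mpoly set)"
  unfolding prime_ideal_def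
proof (intro conjI allI impI)
  show "ideals.subspace (var_ideal S :: ('v, 'k) mpoly set)" by (rule var_ideal_subspace)
  have "1 \<notin> (var_ideal S :: ('v, 'k) mpoly set)" by (simp add: var_ideal_def monomial_ideal_def)
  then show "var_ideal S \<noteq> (UNIV :: ('v, 'k) mpoly set)" by blast
next
  fix a b :: "('v, 'k) mpoly"
  assume ab: "a * b \<in> var_ideal S"
  show "a \<in> var_ideal S \<or> b \<in> var_ideal S"
  proof (rule ccontr)
    assume neg: "\<not> (a \<in> var_ideal S \<or> b \<in> var_ideal S)"
    obtain ma where ma: "ma \<in> mons a" "supp ma \<inter> S = {}"
      "\<And>k. k \<in> mons a \<Longrightarrow> supp k \<inter> S = {} \<Longrightarrow> expo_key k \<le> expo_key ma"
      using leading_monomial_outside[of a S] neg by blast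
    obtain mb where mb: "mb \<in> mons b" "supp mb \<inter> S = {}"
      "\<And>k. k \<in> mons b \<Longrightarrow> supp k \<inter> S = {} \<Longrightarrow> expo_key k \<le> expo_key mb"
      using leading_monomial_outside[of b S] neg by blast
    \<comment> \<open>Any other way to reach the exponent \<open>ma + mb\<close> would use a monomial above \<open>ma\<close> or \<open>mb\<close>.\<close>
    have z: "coef (Poly_Mapping.single m (coef a m) * b) (ma + mb) = 0"
      if m: "m \<in> mons a" "m \<noteq> ma" for m
    proof (rule ccontr)
      assume nz: "coef (Poly_Mapping.single m (coef a m) * b) (ma + mb) \<noteq> 0"
      then obtain l where l: "ma + mb = m + l"
        using coef_single_mult_not_shift by blast
      then have lb: "l \<in> mons b" using nz by (simp add: coef_single_mult_shift in_keys_iff)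
      have "supp m \<union> supp l = supp ma \<union> supp mb" using l by (metis supp_add)
      then have "supp m \<inter> S = {}" "supp l \<inter> S = {}" using ma(2) mb(2) by blast+
      then have "expo_key m \<le> expo_key ma" "expo_key l \<le> expo_key mb"
        using ma(3) mb(3) m(1) lb by auto
      moreover have "expo_key ma + expo_key mb = expo_key m + expo_key l"
        using l by (metis expo_key_add)
      ultimately have "expo_key m = expo_key ma"
        by (metis add_less_le_mono order_le_imp_less_or_eq less_irrefl)
      then show False using m(2) by (simp add: expo_key_inject)
    qed
    have "a * b = (\<Sum>m\<in>mons a. Poly_Mapping.single m (coef a m) * b)"
      by (subst mpoly_expand[of a]) (simp add: sum_distrib_right)
    then have "coef (a * b) (ma + mb)
        = (\<Sum>m\<in>mons a. coef (Poly_Mapping.single m (coef a m) * b) (ma + mb))"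
      by (simp add: lookup_sum)
    also have "\<dots> = (\<Sum>m\<in>{ma}. coef (Poly_Mapping.single m (coef a m) * b) (ma + mb))"
      using ma(1) z by (intro sum.mono_neutral_right) auto
    also have "\<dots> = coef a ma * coef b mb" by (simp add: coef_single_mult_shift)
    also have "\<dots> \<noteq> 0" using ma(1) mb(1) by (simp add: in_keys_iff)
    finally have "ma + mb \<in> mons (a * b)" by (simp add: in_keys_iff)
    then have "supp (ma + mb) \<inter> S \<noteq> {}" using ab by (auto simp: var_ideal_def monomial_ideal_def)
    then show False using ma(2) mb(2) by (auto simp: supp_add)
  qed
qed

lemma var_in_var_ideal: "(var v :: ('v, 'k::field) mpoly) \<in> var_ideal S \<longleftrightarrow> v \<in> S"
  by (simp add: var_ideal_def monomial_ideal_def var_def)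

text \<open>Chains are bounded by \<open>prime_chain_length_le\<close>; one of maximal length is obtained by adjoining
the remaining variables one at a time to \<open>S0\<close>.\<close>

proposition krull_dim_eq:
  fixes I :: "('v::finite, 'k::field) mpoly set"
  assumes up: "\<And>P. prime_ideal P \<Longrightarrow> I \<subseteq> P \<Longrightarrow> \<exists>S. card S = h \<and> var ` S \<subseteq> P"
    and low: "card S0 = h" "I \<subseteq> var_ideal S0"
  shows "krull_dim I = card (UNIV :: 'v set) - h"
proof -
  define L where "L = {l. \<exists>P :: nat \<Rightarrow> ('v, 'k) mpoly set.
            (\<forall>i\<le>l. prime_ideal (P i) \<and> I \<subseteq> P i) \<and> (\<forall>i<l. P i \<subset> P (Suc i))}"
  let ?k = "card (UNIV :: 'v set) - h"
  have compl: "card (- S) = card (UNIV :: 'v set) - card S" for S :: "'v set"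
    by (simp add: Compl_eq_Diff_UNIV card_Diff_subset)
  have "l \<le> ?k" if l: "l \<in> L" for l
  proof -
    obtain P where *: "(\<forall>i\<le>l. prime_ideal (P i) \<and> I \<subseteq> P i) \<and> (\<forall>i<l. P i \<subset> P (Suc i))"
      using l unfolding L_def mem_Collect_eq by blast
    have P: "\<And>i. i \<le> l \<Longrightarrow> prime_ideal (P i)" "\<And>i. i \<le> l \<Longrightarrow> I \<subseteq> P i"
      "\<And>i. i < l \<Longrightarrow> P i \<subset> P (Suc i)" using * by simp_all
    obtain S where "card S = h" "var ` S \<subseteq> P 0" using up P(1,2)[of 0] by auto
    then show ?thesis using prime_chain_length_le[of l P S] P by (simp add: compl)
  qed
  moreover have "?k \<in> L"
  proof -
    have "card (- S0) = ?k" using low(1) by (simp add: compl)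
    then obtain e where e: "bij_betw e {0..<?k} (- S0)"
      using ex_bij_betw_nat_finite[of "- S0"] by auto
    define P :: "nat \<Rightarrow> ('v, 'k) mpoly set" where "P i = var_ideal (S0 \<union> e ` {0..<i})" for i
    have "I \<subseteq> P i" for i
      using low(2) unfolding P_def var_ideal_def monomial_ideal_def by blast
    moreover have "P i \<subset> P (Suc i)" if i: "i < ?k" for i
    proof
      show "P i \<subseteq> P (Suc i)" unfolding P_def var_ideal_def monomial_ideal_def
        by (fastforce simp: atLeast0_lessThan_Suc)
      have "e i \<notin> S0" using e i by (auto simp: bij_betw_def)
      moreover have "e i \<notin> e ` {0..<i}"
        using bij_betw_imp_inj_on[OF e] i by (auto dest: inj_onD)
      ultimately have "(var (e i) :: ('v, 'k) mpoly) \<notin> P i" "var (e i) \<in> P (Suc i)"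
        by (auto simp: P_def var_in_var_ideal)
      then show "P i \<noteq> P (Suc i)" by blast
    qed
    moreover have "prime_ideal (P i)" for i unfolding P_def by (rule var_ideal_prime)
    ultimately show ?thesis unfolding L_def mem_Collect_eq by (intro exI[of _ P]) simp
  qed
  ultimately have "Sup L = ?k" by (intro cSup_eq_maximum)
  then show ?thesis by (simp add: krull_dim_def L_def)
qed

section \<open>Hilbert series of monomial ideals\<close>

lemma finite_mon_degree: "finite {m :: 'v::finite \<Rightarrow>\<^sub>0 nat. mon_degree m = d}"
proof (rule finite_subset)
  show "{m :: 'v \<Rightarrow>\<^sub>0 nat. mon_degree m = d} \<subseteq> {m. supp m \<inter> {} = {} \<and> (\<forall>v. expo m v \<le> d)}"
    by (auto simp: mon_degree_def intro: member_le_sum)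
qed (rule card_bounded_monomials(1))

lemma k_dim_monomial_span:
  assumes M: "finite M"
  shows "k_dim {p :: ('v, 'k::field) mpoly. mons p \<subseteq> M} = card M"
proof -
  have "kvs.independent ((\<lambda>m. Poly_Mapping.single m (1::'k)) ` M)"
    using indep_family_independent[OF M indep_family_monomials[OF M]] .
  moreover have "(\<lambda>m. Poly_Mapping.single m (1::'k)) ` M \<subseteq> {p. mons p \<subseteq> M}" by auto
  moreover have "{p :: ('v, 'k) mpoly. mons p \<subseteq> M} \<subseteq> kvs.span ((\<lambda>m. Poly_Mapping.single m (1::'k)) ` M)"
    using span_monomials by blast
  ultimately have "card ((\<lambda>m. Poly_Mapping.single m (1::'k)) ` M) = k_dim {p :: ('v, 'k) mpoly. mons p \<subseteq> M}"
    by (intro kvs.basis_card_eq_dim)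
  then show ?thesis
    using card_image[OF indep_family_inj[OF M indep_family_monomials[OF M, where 'k = 'k]]] by simp
qed

text \<open>The generating function of a set of monomials by degree.\<close>

definition mon_gf :: "('v::finite \<Rightarrow>\<^sub>0 nat) set \<Rightarrow> int fps" where
  "mon_gf M = Abs_fps (\<lambda>d. int (card {m \<in> M. mon_degree m = d}))"

lemma finite_mon_degree': "finite {m :: 'v::finite \<Rightarrow>\<^sub>0 nat. m \<in> M \<and> mon_degree m = d}"
  by (rule finite_subset[OF _ finite_mon_degree[of d]]) auto

lemma mon_gf_Un:
  assumes "M \<inter> N = {}"
  shows "mon_gf (M \<union> N) = mon_gf M + mon_gf N"
proof (rule fps_ext)
  fix d
  have "{m \<in> M \<union> N. mon_degree m = d} = {m \<in> M. mon_degree m = d} \<union> {m \<in> N. mon_degree m = d}"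
    by auto
  then show "fps_nth (mon_gf (M \<union> N)) d = fps_nth (mon_gf M + mon_gf N) d"
    using assms by (simp add: mon_gf_def card_Un_disjoint finite_mon_degree' disjoint_iff)
qed

lemma mon_gf_UN:
  assumes "finite A" "\<And>a b. a \<in> A \<Longrightarrow> b \<in> A \<Longrightarrow> a \<noteq> b \<Longrightarrow> M a \<inter> M b = {}"
  shows "mon_gf (\<Union>a\<in>A. M a) = (\<Sum>a\<in>A. mon_gf (M a))"
  using assms
proof (induction A rule: finite_induct)
  case empty
  show ?case by (simp add: mon_gf_def fps_eq_iff)
next
  case (insert a A)
  have "M a \<inter> (\<Union>b\<in>A. M b) = {}" using insert.prems insert.hyps(2) by fastforce
  then show ?case using insert by (simp add: mon_gf_Un)
qed

lemma mon_gf_shift: "mon_gf ((+) a ` M) = fps_X ^ mon_degree a * mon_gf M"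
proof (rule fps_ext)
  fix d
  have *: "{m \<in> (+) a ` M. mon_degree m = d} = (+) a ` {m \<in> M. mon_degree a + mon_degree m = d}"
    by (auto simp: mon_degree_add)
  have "card {m \<in> (+) a ` M. mon_degree m = d} = card {m \<in> M. mon_degree a + mon_degree m = d}"
    unfolding * by (intro card_image) auto
  moreover have "{m \<in> M. mon_degree a + mon_degree m = d}
      = (if d < mon_degree a then {} else {m \<in> M. mon_degree m = d - mon_degree a})"
    by auto
  ultimately show "fps_nth (mon_gf ((+) a ` M)) d = fps_nth (fps_X ^ mon_degree a * mon_gf M) d"
    by (simp add: mon_gf_def fps_X_power_mult_nth)
qed

lemma mon_degree_single: "mon_degree (Poly_Mapping.single v n) = n"
  by (simp add: mon_degree_def lookup_single when_def)

text \<open>A monomial in the variables \<open>insert v A\<close> either does not involve \<open>v\<close> or is \<open>x\<^sub>v\<close> times another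
such monomial, so each variable contributes a factor \<open>1 / (1 - X)\<close>.\<close>

lemma mon_gf_supported:
  fixes A :: "'v::finite set"
  shows "mon_gf {m. supp m \<subseteq> A} * (1 - fps_X) ^ card A = 1"
proof (induction A rule: finite_induct[OF finite])
  case 1
  have "{m :: 'v \<Rightarrow>\<^sub>0 nat. m = 0 \<and> mon_degree m = d} = (if d = 0 then {0} else {})" for d
    by (auto simp: mon_degree_0)
  then show ?case by (simp add: mon_gf_def fps_eq_iff)
next
  case (2 v A)
  let ?e = "Poly_Mapping.single v (1::nat)"
  have "{m. supp m \<subseteq> insert v A} = {m. supp m \<subseteq> A} \<union> (+) ?e ` {m. supp m \<subseteq> insert v A}"
  proof (rule Set.set_eqI, rule iffI)
    fix m assume m: "m \<in> {m. supp m \<subseteq> insert v A}"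
    show "m \<in> {m. supp m \<subseteq> A} \<union> (+) ?e ` {m. supp m \<subseteq> insert v A}"
    proof (cases "v \<in> supp m")
      case True
      then have "m \<in> range ((+) ?e)"
        by (auto simp: range_shift_iff lookup_single when_def in_keys_iff)
      then obtain k where "m = ?e + k" by blast
      then show ?thesis using m by (auto simp: supp_add)
    qed (use m in auto)
  qed (auto simp: supp_add)
  then have "mon_gf {m. supp m \<subseteq> insert v A}
      = mon_gf ({m. supp m \<subseteq> A} \<union> (+) ?e ` {m. supp m \<subseteq> insert v A})" by simp
  also have "\<dots> = mon_gf {m. supp m \<subseteq> A} + fps_X * mon_gf {m. supp m \<subseteq> insert v A}"
    using 2 by (subst mon_gf_Un) (auto simp: supp_add mon_gf_shift mon_degree_single)
  finally have "mon_gf {m. supp m \<subseteq> insert v A} * (1 - fps_X) = mon_gf {m. supp m \<subseteq> A}"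
    by (simp add: algebra_simps)
  then show ?case using 2 by (simp flip: mult.assoc)
qed

text \<open>The monomials outside \<open>M\<close> form a basis of the quotient.\<close>

lemma hilbert_series_monomial_ideal:
  fixes M :: "('v::finite \<Rightarrow>\<^sub>0 nat) set"
  shows "hilbert_series (monomial_ideal M :: ('v, 'k::field) mpoly set) = mon_gf (- M)"
proof (rule fps_ext)
  fix d
  let ?D = "{m :: 'v \<Rightarrow>\<^sub>0 nat. mon_degree m = d}"
  have "{p :: ('v, 'k) mpoly. homogeneous (int d) p} = {p. mons p \<subseteq> ?D}"
    by (auto simp: homogeneous_def)
  then have 1: "k_dim {p :: ('v, 'k) mpoly. homogeneous (int d) p} = card ?D"
    by (simp only: k_dim_monomial_span[OF finite_mon_degree])
  have "{p \<in> monomial_ideal M :: ('v, 'k) mpoly set. homogeneous (int d) p}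
      = {p. mons p \<subseteq> {m \<in> M. mon_degree m = d}}"
    by (auto simp: homogeneous_def monomial_ideal_def)
  then have 2: "k_dim {p \<in> monomial_ideal M :: ('v, 'k) mpoly set. homogeneous (int d) p}
      = card {m \<in> M. mon_degree m = d}"
    by (simp only: k_dim_monomial_span[OF finite_mon_degree'])
  have "card ?D = card {m \<in> M. mon_degree m = d} + card {m \<in> - M. mon_degree m = d}"
    by (subst card_Un_disjoint[symmetric])
      (use finite_mon_degree'[of "- M" d] in \<open>auto simp: finite_mon_degree' intro!: arg_cong[of _ _ card]\<close>)
  then show "fps_nth (hilbert_series (monomial_ideal M :: ('v, 'k) mpoly set)) d = fps_nth (mon_gf (- M)) d"
    by (simp add: hilbert_series_def hilbert_function_def mon_gf_def 1 2)
qed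

section \<open>Cover ideals are monomial ideals\<close>

definition indicator_mon :: "'v::finite set \<Rightarrow> ('v \<Rightarrow>\<^sub>0 nat)" where
  "indicator_mon A = (\<Sum>v\<in>A. Poly_Mapping.single v 1)"

lemma expo_indicator: "expo (indicator_mon A) v = (if v \<in> A then 1 else 0)"
  by (simp add: indicator_mon_def lookup_sum lookup_single when_def)

lemma supp_indicator: "supp (indicator_mon A) = A"
  by (auto simp: in_keys_iff expo_indicator split: if_splits)

lemma mon_degree_indicator: "mon_degree (indicator_mon A) = card A"
  by (simp add: mon_degree_def expo_indicator sum.If_cases)

lemma range_indicator: "m \<in> range ((+) (indicator_mon A)) \<longleftrightarrow> A \<subseteq> supp m"
  by (auto simp: range_shift_iff expo_indicator in_keys_iff Suc_le_eq)

lemma prod_var: "(\<Prod>v\<in>A. var v) = (xpow (indicator_mon A) :: ('v::finite, 'k::field) mpoly)"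
proof -
  have "finite A" by simp
  then show ?thesis
    by (induction A rule: finite_induct) (auto simp: indicator_mon_def var_def mult_single)
qed

lemma shift_indicator:
  assumes "A \<subseteq> B"
  shows "(+) (indicator_mon A) ` {m. supp m \<subseteq> B} = {m. A \<subseteq> supp m \<and> supp m \<subseteq> B}"
proof (rule Set.set_eqI, rule iffI)
  fix m assume m: "m \<in> {m. A \<subseteq> supp m \<and> supp m \<subseteq> B}"
  then have "m \<in> range ((+) (indicator_mon A))" by (simp only: range_indicator mem_Collect_eq)
  then obtain k where k: "m = indicator_mon A + k" by blast
  then have "supp k \<subseteq> B" using m by (simp add: supp_add)
  then show "m \<in> (+) (indicator_mon A) ` {m. supp m \<subseteq> B}" using k by blast
qed (use assms in \<open>auto simp: supp_add supp_indicator\<close>)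

lemma minimal_vertex_cover_exists:
  assumes "vertex_cover E (W :: 'v::finite set)"
  shows "\<exists>W'\<subseteq>W. minimal_vertex_cover E W'"
proof -
  have "finite W" by simp
  then show ?thesis using assms
  proof (induction W rule: finite_psubset_induct)
    case (psubset W)
    show ?case
    proof (cases "minimal_vertex_cover E W")
      case False
      then obtain W' where "W' \<subset> W" "vertex_cover E W'"
        using psubset.prems by (auto simp: minimal_vertex_cover_def)
      then show ?thesis using psubset.IH[of W'] by (meson psubset_imp_subset subset_trans)
    qed blast
  qed
qed

text \<open>Every vertex cover contains a minimal one, so a monomial lies in the cover ideal iff its
support is a vertex cover. Membership can therefore be read off from a description of all covers.\<close>

lemma cover_ideal_monomial:
  fixes E :: "'v::finite set set"
  shows "(cover_ideal E :: ('v, 'k::field) mpoly set) = monomial_ideal {m. vertex_cover E (supp m)}"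
    (is "_ = ?J")
proof
  have "ideals.subspace ?J"
    by (rule monomial_ideal_subspace) (auto simp: supp_add vertex_cover_def)
  then show "cover_ideal E \<subseteq> ?J"
    unfolding cover_ideal_def
    by (intro ideals.span_minimal)
      (auto simp: prod_var monomial_ideal_def supp_indicator minimal_vertex_cover_def)
next
  show "?J \<subseteq> cover_ideal E"
  proof
    fix p :: "('v, 'k) mpoly" assume p: "p \<in> ?J"
    have "p = (\<Sum>m\<in>mons p. Poly_Mapping.single m (coef p m))" by (rule mpoly_expand)
    also have "\<dots> \<in> cover_ideal E"
      unfolding cover_ideal_def
    proof (rule ideals.span_sum)
      fix m assume "m \<in> mons p"
      then have "vertex_cover E (supp m)" using p by (auto simp: monomial_ideal_def)
      then obtain W where W: "W \<subseteq> supp m" "minimal_vertex_cover E W"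
        using minimal_vertex_cover_exists by blast
      obtain k where "m = indicator_mon W + k" using W(1) range_indicator[of m W] by auto
      then have eq: "Poly_Mapping.single m (coef p m)
          = Poly_Mapping.single k (coef p m) * (\<Prod>v\<in>W. var v)"
        by (simp add: prod_var mult_single add.commute)
      have "(\<Prod>v\<in>W. var v :: ('v, 'k) mpoly) \<in> {\<Prod>v\<in>W. var v | W. minimal_vertex_cover E W}"
        using W(2) by blast
      then show "Poly_Mapping.single m (coef p m)
          \<in> ideal_gen {\<Prod>v\<in>W. var v | W. minimal_vertex_cover E W}"
        unfolding eq by (intro ideals.span_scale ideals.span_base)
    qed
    finally show "p \<in> cover_ideal E" .
  qed
qed

section \<open>Dimension and \<open>h\<close>-polynomial for split graphs\<close>

text \<open>The partition into \<open>C\<close> and its complement, normalised such that every vertex of the clique has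
a neighbour on the independent side. Without the last condition the relation attached to such
a vertex would have a constant coefficient and the resolution below would not be minimal.\<close>

locale split_partition =
  fixes E :: "'v::finite set set" and C :: "'v set"
  assumes simple: "simple_graph E"
    and clique: "u \<in> C \<Longrightarrow> v \<in> C \<Longrightarrow> u \<noteq> v \<Longrightarrow> {u, v} \<in> E"
    and indep: "u \<notin> C \<Longrightarrow> v \<notin> C \<Longrightarrow> {u, v} \<notin> E"
    and nonempty: "C \<noteq> {}"
    and has_nbr: "v \<in> C \<Longrightarrow> \<exists>u. u \<notin> C \<and> {v, u} \<in> E"
begin

definition nbhd :: "'v \<Rightarrow> 'v set" where "nbhd v = {u. u \<notin> C \<and> {v, u} \<in> E}"

text \<open>The smallest vertex cover that avoids \<open>v \<in> C\<close>.\<close>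

definition cover_off :: "'v \<Rightarrow> 'v set" where "cover_off v = (C - {v}) \<union> nbhd v"

definition dmax :: nat where "dmax = Max ((\<lambda>v. card (nbhd v)) ` C)"

lemma card_nbhd_pos: "v \<in> C \<Longrightarrow> card (nbhd v) \<ge> 1"
  using has_nbr[of v] by (auto simp: nbhd_def Suc_le_eq card_gt_0_iff)

lemma card_C_pos: "card C \<ge> 1"
  using nonempty by (simp add: Suc_le_eq card_gt_0_iff)

lemma card_nbhd_le_dmax: "v \<in> C \<Longrightarrow> card (nbhd v) \<le> dmax"
  by (simp add: dmax_def)

lemma dmax_attained: "\<exists>v\<in>C. card (nbhd v) = dmax"
proof -
  have "dmax \<in> (\<lambda>v. card (nbhd v)) ` C" unfolding dmax_def using nonempty by (intro Max_in) auto
  then show ?thesis by auto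
qed

lemma dmax_pos: "dmax \<ge> 1"
  using dmax_attained card_nbhd_pos by metis

lemma card_cover_off: "v \<in> C \<Longrightarrow> card (cover_off v) = card C - 1 + card (nbhd v)"
  unfolding cover_off_def by (subst card_Un_disjoint) (auto simp: nbhd_def)

lemma vertex_cover_iff: "vertex_cover E W \<longleftrightarrow> C \<subseteq> W \<or> (\<exists>v\<in>C. v \<notin> W \<and> cover_off v \<subseteq> W)"
proof
  assume W: "vertex_cover E W"
  show "C \<subseteq> W \<or> (\<exists>v\<in>C. v \<notin> W \<and> cover_off v \<subseteq> W)"
  proof (rule disjCI)
    assume "\<not> (\<exists>v\<in>C. v \<notin> W \<and> cover_off v \<subseteq> W)"
    moreover have "cover_off v \<subseteq> W" if "v \<in> C" "v \<notin> W" for v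
    proof
      fix u assume "u \<in> cover_off v"
      then have "{v, u} \<in> E" using clique that by (auto simp: cover_off_def nbhd_def)
      then have "{v, u} \<inter> W \<noteq> {}" by (rule bspec[OF W[unfolded vertex_cover_def]])
      then show "u \<in> W" using that by auto
    qed
    ultimately show "C \<subseteq> W" by blast
  qed
next
  assume *: "C \<subseteq> W \<or> (\<exists>v\<in>C. v \<notin> W \<and> cover_off v \<subseteq> W)"
  show "vertex_cover E W"
    unfolding vertex_cover_def
  proof
    fix e assume e: "e \<in> E"
    then have "card e = 2" using simple by (simp add: simple_graph_def)
    then obtain a b where ab: "e = {a, b}" "a \<noteq> b" by (auto simp: card_2_iff)
    have "\<exists>a b. e = {a, b} \<and> a \<noteq> b \<and> a \<in> C"
    proof (cases "a \<in> C")
      case False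
      then have "b \<in> C" using indep[of a b] e ab by auto
      then show ?thesis using ab by (intro exI[of _ b] exI[of _ a]) auto
    qed (use ab in blast)
    then obtain a b where ab: "e = {a, b}" "a \<noteq> b" "a \<in> C" by blast
    show "e \<inter> W \<noteq> {}"
    proof (cases "C \<subseteq> W")
      case False
      then obtain v where v: "v \<in> C" "v \<notin> W" "cover_off v \<subseteq> W" using * by blast
      show ?thesis
      proof (cases "a = v")
        case True
        then have "b \<in> cover_off v" using ab e by (auto simp: cover_off_def nbhd_def)
        then show ?thesis using v ab by auto
      next
        case False
        then show ?thesis using v ab by (auto simp: cover_off_def)
      qed
    qed (use ab in auto)
  qed
qed

lemma card_UNIV_ge_2: "card (UNIV :: 'v set) \<ge> 2"
proof -
  obtain v where v: "v \<in> C" using nonempty by blast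
  then obtain u where "u \<notin> C" using has_nbr by blast
  then have "card {u, v} = 2" using v by (auto simp: card_2_iff)
  then show ?thesis using card_mono[of UNIV "{u, v}"] by simp
qed

text \<open>The monomials are sorted by the variable of the clique that they do not involve, if any; a
vertex cover misses at most one vertex of a clique, so the pieces will be disjoint.\<close>

lemma cover_monomials_decompose:
  "{m. vertex_cover E (supp m)} = (+) (indicator_mon C) ` {m. supp m \<subseteq> UNIV}
     \<union> (\<Union>v\<in>C. (+) (indicator_mon (cover_off v)) ` {m. supp m \<subseteq> - {v}})"
proof -
  have "cover_off v \<subseteq> - {v}" if "v \<in> C" for v using that by (auto simp: cover_off_def nbhd_def)
  then have "(+) (indicator_mon (cover_off v)) ` {m. supp m \<subseteq> - {v}} = {m. v \<notin> supp m \<and> cover_off v \<subseteq> supp m}"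
    if "v \<in> C" for v using that by (subst shift_indicator) auto
  then show ?thesis
    unfolding vertex_cover_iff by (subst shift_indicator) auto
qed

lemma mon_gf_cover:
  "mon_gf {m. vertex_cover E (supp m)} * (1 - fps_X) ^ card (UNIV :: 'v set)
     = fps_X ^ card C + (1 - fps_X) * (\<Sum>v\<in>C. fps_X ^ (card C - 1 + card (nbhd v)))"
proof -
  let ?n = "card (UNIV :: 'v set)"
  have disj: "(+) (indicator_mon C) ` {m. supp m \<subseteq> UNIV}
     \<inter> (\<Union>v\<in>C. (+) (indicator_mon (cover_off v)) ` {m. supp m \<subseteq> - {v}}) = {}"
  proof -
    have "v \<in> supp m" if "m \<in> (+) (indicator_mon C) ` {m. supp m \<subseteq> UNIV}" "v \<in> C" for m v
      using that by (auto simp: supp_add supp_indicator)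
    moreover have "v \<notin> supp m" if "v \<in> C" "m \<in> (+) (indicator_mon (cover_off v)) ` {m. supp m \<subseteq> - {v}}" for m v
      using that by (auto simp: supp_add supp_indicator cover_off_def nbhd_def)
    ultimately show ?thesis by blast
  qed
  have disj2: "(+) (indicator_mon (cover_off v)) ` {m. supp m \<subseteq> - {v}}
     \<inter> (+) (indicator_mon (cover_off w)) ` {m. supp m \<subseteq> - {w}} = {}" if "v \<in> C" "w \<in> C" "v \<noteq> w" for v w
  proof -
    have "w \<in> supp m" if "m \<in> (+) (indicator_mon (cover_off v)) ` {m. supp m \<subseteq> - {v}}" for m
      using that \<open>w \<in> C\<close> \<open>v \<noteq> w\<close> by (auto simp: supp_add supp_indicator cover_off_def)
    moreover have "w \<notin> supp m" if "m \<in> (+) (indicator_mon (cover_off w)) ` {m. supp m \<subseteq> - {w}}" for m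
      using that \<open>w \<in> C\<close> by (auto simp: supp_add supp_indicator cover_off_def nbhd_def)
    ultimately show ?thesis by blast
  qed
  have "mon_gf {m. vertex_cover E (supp m)} = fps_X ^ card C * mon_gf {m :: 'v \<Rightarrow>\<^sub>0 nat. supp m \<subseteq> UNIV}
      + (\<Sum>v\<in>C. fps_X ^ (card C - 1 + card (nbhd v)) * mon_gf {m. supp m \<subseteq> - {v}})"
    unfolding cover_monomials_decompose mon_gf_Un[OF disj] mon_gf_shift mon_degree_indicator
    by (subst mon_gf_UN) (use disj2 in \<open>auto simp: mon_gf_shift mon_degree_indicator card_cover_off\<close>)
  then have "mon_gf {m. vertex_cover E (supp m)} * (1 - fps_X) ^ ?n
      = fps_X ^ card C * (mon_gf {m :: 'v \<Rightarrow>\<^sub>0 nat. supp m \<subseteq> UNIV} * (1 - fps_X) ^ ?n)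
      + (\<Sum>v\<in>C. fps_X ^ (card C - 1 + card (nbhd v)) * (mon_gf {m. supp m \<subseteq> - {v}} * (1 - fps_X) ^ ?n))"
    by (simp only: distrib_right sum_distrib_right mult.assoc)
  moreover have "mon_gf {m :: 'v \<Rightarrow>\<^sub>0 nat. supp m \<subseteq> UNIV} * (1 - fps_X) ^ ?n = 1"
    by (rule mon_gf_supported)
  moreover have "mon_gf {m. supp m \<subseteq> - {v}} * (1 - fps_X) ^ ?n = 1 - fps_X" for v :: 'v
  proof -
    have "?n = Suc (card (- {v}))" using card_UNIV_ge_2 by (simp add: Compl_eq_Diff_UNIV card_Diff_subset)
    then have "(1 - fps_X :: int fps) ^ ?n = (1 - fps_X) ^ card (- {v}) * (1 - fps_X)" by simp
    then have "mon_gf {m. supp m \<subseteq> - {v}} * (1 - fps_X) ^ ?n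
        = mon_gf {m. supp m \<subseteq> - {v}} * (1 - fps_X) ^ card (- {v}) * (1 - fps_X)"
      by (simp only: mult.assoc)
    then show ?thesis by (simp only: mon_gf_supported mult_1_left)
  qed
  ultimately have "mon_gf {m. vertex_cover E (supp m)} * (1 - fps_X) ^ ?n
      = fps_X ^ card C + (\<Sum>v\<in>C. fps_X ^ (card C - 1 + card (nbhd v)) * (1 - fps_X))"
    by (simp only: mult_1_right)
  then show ?thesis by (simp only: sum_distrib_left mult.commute)
qed

lemma hilbert_series_cover:
  "hilbert_series (cover_ideal E :: ('v, 'k::field) mpoly set) * (1 - fps_X) ^ card (UNIV :: 'v set)
     = 1 - fps_X ^ card C - (1 - fps_X) * (\<Sum>v\<in>C. fps_X ^ (card C - 1 + card (nbhd v)))"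
proof -
  let ?n = "card (UNIV :: 'v set)" and ?M = "{m :: 'v \<Rightarrow>\<^sub>0 nat. vertex_cover E (supp m)}"
  have "mon_gf {m :: 'v \<Rightarrow>\<^sub>0 nat. supp m \<subseteq> UNIV} = mon_gf (?M \<union> - ?M)"
    by (rule arg_cong[of _ _ mon_gf]) auto
  also have "\<dots> = mon_gf ?M + mon_gf (- ?M)" by (rule mon_gf_Un) auto
  finally have "1 = mon_gf ?M * (1 - fps_X) ^ ?n + mon_gf (- ?M) * (1 - fps_X) ^ ?n"
    using mon_gf_supported[of "UNIV :: 'v set"] by (simp add: distrib_right)
  then show ?thesis
    unfolding cover_ideal_monomial hilbert_series_monomial_ideal mon_gf_cover by (simp add: algebra_simps)
qed

text \<open>A prime that contains the monomial of \<open>C\<close> contains a variable \<open>u \<in> C\<close>, and because it also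
contains the monomial of \<open>cover_off u\<close>, it contains a second one. Conversely the two ends of an edge
generate a prime that contains the cover ideal.\<close>

lemma krull_dim_cover:
  "krull_dim (cover_ideal E :: ('v, 'k::field) mpoly set) = card (UNIV :: 'v set) - 2"
proof (rule krull_dim_eq)
  fix P :: "('v, 'k) mpoly set"
  assume P: "prime_ideal P" and sub: "cover_ideal E \<subseteq> P"
  have prime_prod: "\<exists>v\<in>A. var v \<in> P" if "(\<Prod>v\<in>A. var v) \<in> P" for A :: "'v set"
  proof -
    have "finite A" by simp
    then show ?thesis using that
      by (induction A rule: finite_induct) (use prime_idealD[OF P] in auto)
  qed
  have cov: "(\<Prod>v\<in>W. var v) \<in> P" if "vertex_cover E W" for W
  proof -
    have "(\<Prod>v\<in>W. var v) \<in> (cover_ideal E :: ('v, 'k) mpoly set)"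
      using that by (simp add: cover_ideal_monomial prod_var monomial_ideal_def supp_indicator)
    then show ?thesis using sub by blast
  qed
  obtain u where u: "u \<in> C" "var u \<in> P" using prime_prod[OF cov[of C]] by (auto simp: vertex_cover_iff)
  have "vertex_cover E (cover_off u)" using u by (auto simp: vertex_cover_iff cover_off_def nbhd_def)
  then obtain w where w: "w \<in> cover_off u" "var w \<in> P" using prime_prod[OF cov] by blast
  then have "u \<noteq> w" using u by (auto simp: cover_off_def nbhd_def)
  then show "\<exists>S. card S = 2 \<and> var ` S \<subseteq> P" using u w by (intro exI[of _ "{u, w}"]) auto
next
  define v where "v = (SOME v. v \<in> C)"
  have v: "v \<in> C" using nonempty by (auto simp: v_def some_in_eq)
  define u where "u = (SOME u. u \<notin> C \<and> {v, u} \<in> E)"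
  have u: "u \<notin> C" "{v, u} \<in> E" using someI_ex[OF has_nbr[OF v]] by (auto simp: u_def)
  show "card {v, u} = 2" using u v by (auto simp: card_2_iff)
  show "cover_ideal E \<subseteq> (var_ideal {v, u} :: ('v, 'k) mpoly set)"
    using u unfolding cover_ideal_monomial var_ideal_def monomial_ideal_def vertex_cover_def by blast
qed

lemma fps_geometric_block:
  assumes "i \<le> j"
  shows "(1 - fps_X) * (\<Sum>k\<in>{i..<j}. fps_X ^ k) = (fps_X ^ i - fps_X ^ j :: int fps)"
  using assms
proof (induction j rule: dec_induct)
  case (step j)
  have "(1 - fps_X) * (\<Sum>k\<in>{i..<Suc j}. fps_X ^ k)
      = (1 - fps_X) * (\<Sum>k\<in>{i..<j}. fps_X ^ k) + (1 - fps_X) * (fps_X ^ j :: int fps)"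
    using step.hyps by (simp add: distrib_left)
  then show ?case unfolding step.IH by (simp add: left_diff_distrib)
qed simp

text \<open>The numerator is divisible by \<open>(1 - X)\<^sup>2\<close>: writing \<open>1 - X^c\<close> as \<open>1 - X\<close> times \<open>c\<close> powers of \<open>X\<close>, one
pairs these powers \<open>X^i\<close> with the \<open>c\<close> powers \<open>X^(c - 1 + d v)\<close>, \<open>d v\<close> being the size of \<open>nbhd v\<close>,
along an arbitrary enumeration of \<open>C\<close>.
Each difference is \<open>1 - X\<close> times a block of consecutive powers, and since \<open>i < c \<le> c - 1 + d v\<close> all
blocks are nonempty. Positive coefficients exclude cancellation in the top degree.\<close>

proposition degree_h_polynomial_cover:
  "int (Polynomial.degree (h_polynomial (cover_ideal E :: ('v, 'k::field) mpoly set)))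
     = int (card C) + int dmax - 2"
proof -
  let ?n = "card (UNIV :: 'v set)" and ?c = "card C"
  let ?H = "hilbert_series (cover_ideal E :: ('v, 'k) mpoly set)"
  define D where "D v = ?c - 1 + card (nbhd v)" for v
  obtain e where e: "bij_betw e {0..<?c} C" using ex_bij_betw_nat_finite[of C] by auto
  have eC: "e i \<in> C" if "i < ?c" for i using e that by (auto simp: bij_betw_def)
  have D_ge: "?c \<le> D v" if "v \<in> C" for v
    using card_nbhd_pos[OF that] card_C_pos unfolding D_def by linarith
  define h :: "int poly" where "h = (\<Sum>i\<in>{0..<?c}. \<Sum>k\<in>{i..<D (e i)}. monom 1 k)"
  have fps_h: "fps_of_poly h = (\<Sum>i\<in>{0..<?c}. \<Sum>k\<in>{i..<D (e i)}. fps_X ^ k)"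
    by (simp add: h_def fps_of_poly_sum fps_of_poly_monom')
  have split_power: "x ^ ?n = x ^ (?n - 2) * (x * x)" for x :: "int fps"
    unfolding power2_eq_square[symmetric] power_add[symmetric]
      le_add_diff_inverse2[OF card_UNIV_ge_2] ..
  have "(1 - fps_X) * fps_of_poly h
      = (\<Sum>i\<in>{0..<?c}. (1 - fps_X) * (\<Sum>k\<in>{i..<D (e i)}. fps_X ^ k))"
    unfolding fps_h by (rule sum_distrib_left)
  also have "\<dots> = (\<Sum>i\<in>{0..<?c}. fps_X ^ i - fps_X ^ D (e i))"
  proof (intro sum.cong refl fps_geometric_block)
    fix i assume "i \<in> {0..<?c}"
    then show "i \<le> D (e i)" using D_ge[OF eC[of i]] by simp
  qed
  also have "\<dots> = (\<Sum>i\<in>{0..<?c}. fps_X ^ i) - (\<Sum>v\<in>C. fps_X ^ D v)"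
    using sum.reindex_bij_betw[OF e, of "\<lambda>v. fps_X ^ D v :: int fps"] by (simp add: sum_subtractf)
  finally have "(1 - fps_X) * ((1 - fps_X) * fps_of_poly h)
      = (1 - fps_X) * (\<Sum>i\<in>{0..<?c}. fps_X ^ i) - (1 - fps_X) * (\<Sum>v\<in>C. fps_X ^ D v)"
    by (simp only: right_diff_distrib)
  also have "(1 - fps_X) * (\<Sum>i\<in>{0..<?c}. fps_X ^ i) = (1 - fps_X ^ ?c :: int fps)"
    using fps_geometric_block[of 0 ?c] by simp
  also have "1 - fps_X ^ ?c - (1 - fps_X) * (\<Sum>v\<in>C. fps_X ^ D v) = ?H * (1 - fps_X) ^ ?n"
    unfolding hilbert_series_cover D_def ..
  also have "(1 - fps_X :: int fps) ^ ?n = (1 - fps_X) ^ (?n - 2) * ((1 - fps_X) * (1 - fps_X))"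
    by (rule split_power)
  finally have "((1 - fps_X) * (1 - fps_X)) * fps_of_poly h
      = ((1 - fps_X) * (1 - fps_X)) * (?H * (1 - fps_X) ^ (?n - 2))"
    by (simp only: mult.assoc mult.commute mult.left_commute)
  moreover have "(1 - fps_X :: int fps) \<noteq> 0"
  proof
    assume "(1 - fps_X :: int fps) = 0"
    then have "fps_nth (1 - fps_X :: int fps) 0 = 0" by simp
    then show False by simp
  qed
  ultimately have "?H * (1 - fps_X) ^ krull_dim (cover_ideal E :: ('v, 'k) mpoly set) = fps_of_poly h"
    unfolding krull_dim_cover by simp
  then have "h_polynomial (cover_ideal E :: ('v, 'k) mpoly set) = h"
    unfolding h_polynomial_def by (intro the_equality) (auto simp: fps_of_poly_eq_iff)
  moreover have "Polynomial.degree h = ?c + dmax - 2"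
  proof -
    have coeff: "poly.coeff h k = int (card {i \<in> {0..<?c}. i \<le> k \<and> k < D (e i)})" for k
    proof -
      have "poly.coeff h k = (\<Sum>i\<in>{0..<?c}. if i \<le> k \<and> k < D (e i) then 1 else 0)"
        unfolding h_def coeff_sum by (intro sum.cong refl) (auto simp: coeff_sum)
      then show ?thesis by (simp add: sum.If_cases Int_def)
    qed
    have c1: "?c \<ge> 1" and d1: "dmax \<ge> 1" by (rule card_C_pos dmax_pos)+
    show ?thesis
    proof (rule antisym)
      show "Polynomial.degree h \<le> ?c + dmax - 2"
      proof (rule degree_le, intro allI impI)
        fix k assume k: "?c + dmax - 2 < k"
        have "D (e i) \<le> k" if "i < ?c" for i
          using card_nbhd_le_dmax[OF eC[OF that]] k c1 d1 unfolding D_def by linarith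
        then have "{i \<in> {0..<?c}. i \<le> k \<and> k < D (e i)} = {}" by force
        then show "poly.coeff h k = 0" by (simp only: coeff card.empty of_nat_0)
      qed
      obtain v where v: "v \<in> C" "card (nbhd v) = dmax" using dmax_attained by blast
      then have "v \<in> e ` {0..<?c}" using bij_betw_imp_surj_on[OF e] by simp
      then obtain i where i: "i < ?c" "e i = v" by auto
      have "i \<in> {i \<in> {0..<?c}. i \<le> ?c + dmax - 2 \<and> ?c + dmax - 2 < D (e i)}"
        using i v c1 d1 by (auto simp: D_def)
      then have "card {i \<in> {0..<?c}. i \<le> ?c + dmax - 2 \<and> ?c + dmax - 2 < D (e i)} \<noteq> 0"
        by (subst card_0_eq) auto
      then have "poly.coeff h (?c + dmax - 2) \<noteq> 0" by (simp only: coeff of_nat_eq_0_iff not_False_eq_True)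
      then show "?c + dmax - 2 \<le> Polynomial.degree h" by (rule le_degree)
    qed
  qed
  ultimately show ?thesis using card_C_pos dmax_pos by simp
qed

end

section \<open>Resolution and regularity for split graphs\<close>

lemma mat_kernel_trivial:
  fixes A B :: "'a::comm_ring_1 mat"
  assumes A: "A \<in> carrier_mat n l" and inj: "\<And>w. w \<in> carrier_vec l \<Longrightarrow> A *\<^sub>v w = 0\<^sub>v n \<Longrightarrow> w = 0\<^sub>v l"
    and B: "B \<in> carrier_mat l 0"
  shows "mat_kernel A = (*\<^sub>v) B ` carrier_vec 0"
proof -
  have B0: "B *\<^sub>v w = 0\<^sub>v l" if "w \<in> carrier_vec 0" for w
    using B that by (intro eq_vecI) (auto simp: scalar_prod_def)
  have A0: "A *\<^sub>v 0\<^sub>v l = 0\<^sub>v n"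
    using A by (intro eq_vecI) (auto simp: scalar_prod_def)
  have "mat_kernel A = {0\<^sub>v l}"
    using inj A A0 mat_kernelD[OF A] mat_kernelI[OF A] by auto
  also have "\<dots> = (*\<^sub>v) B ` carrier_vec 0"
  proof (intro equalityI subsetI)
    fix v :: "'a vec" assume "v \<in> {0\<^sub>v l}"
    then show "v \<in> (*\<^sub>v) B ` carrier_vec 0" using B0[of "0\<^sub>v 0"] by (intro image_eqI[of _ _ "0\<^sub>v 0"]) simp_all
  qed (use B0 in auto)
  finally show ?thesis .
qed

context split_partition
begin

abbreviation x_clique :: "('v, 'k::field) mpoly" where "x_clique \<equiv> xpow (indicator_mon C)"
abbreviation x_cover_off :: "'v \<Rightarrow> ('v, 'k::field) mpoly" where "x_cover_off v \<equiv> xpow (indicator_mon (cover_off v))"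
abbreviation x_nbhd :: "'v \<Rightarrow> ('v, 'k::field) mpoly" where "x_nbhd v \<equiv> xpow (indicator_mon (nbhd v))"

text \<open>The position of a vertex in the list \<open>xs\<close>, an enumeration of \<open>C\<close>, numbers its generator and its
relation; the generator of \<open>C\<close> itself comes first.\<close>

definition res_degrees :: "'v list \<Rightarrow> nat \<Rightarrow> int list" where
  "res_degrees xs i =
     (if i = 0 then [0]
      else if i = 1 then int (card C) # map (\<lambda>v. int (card C - 1 + card (nbhd v))) xs
      else if i = 2 then map (\<lambda>v. int (card C + card (nbhd v))) xs
      else [])"

definition res_map :: "'v list \<Rightarrow> nat \<Rightarrow> ('v, 'k::field) mpoly mat" where
  "res_map xs i =
     (if i = 0 then mat 1 1 (\<lambda>_. 1)
      else if i = 1 then mat 1 (Suc (length xs)) (\<lambda>(_, j). if j = 0 then x_clique else x_cover_off (xs ! (j - 1)))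
      else if i = 2 then mat (Suc (length xs)) (length xs)
        (\<lambda>(r, j). if r = 0 then - x_nbhd (xs ! j) else if r = Suc j then var (xs ! j) else 0)
      else mat (length (res_degrees xs (i - 1))) 0 (\<lambda>_. 0))"

lemma res_map_carrier:
  "res_map xs 0 \<in> carrier_mat 1 1"
  "res_map xs 1 \<in> carrier_mat 1 (Suc (length xs))"
  "res_map xs 2 \<in> carrier_mat (Suc (length xs)) (length xs)"
  "i \<ge> 3 \<Longrightarrow> res_map xs i \<in> carrier_mat (length (res_degrees xs (i - 1))) 0"
  by (auto simp: res_map_def)

lemma res_map_1_mult:
  assumes "u \<in> carrier_vec (Suc (length xs))"
  shows "(res_map xs 1 *\<^sub>v u) $ 0 = x_clique * u $ 0 + (\<Sum>j<length xs. x_cover_off (xs ! j) * u $ Suc j)"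
proof -
  have "(res_map xs 1 *\<^sub>v u) $ 0 = (\<Sum>i<Suc (length xs). res_map xs 1 $$ (0, i) * u $ i)"
    by (rule mat_vec_mult_entry[OF res_map_carrier(2) assms]) simp
  also have "\<dots> = (\<Sum>i<Suc (length xs). (if i = 0 then x_clique else x_cover_off (xs ! (i - 1))) * u $ i)"
    by (intro sum.cong refl) (simp add: res_map_def)
  also have "\<dots> = x_clique * u $ 0 + (\<Sum>j<length xs. x_cover_off (xs ! j) * u $ Suc j)"
    by (subst sum.lessThan_Suc_shift) simp
  finally show ?thesis .
qed

lemma res_map_2_mult_0:
  assumes "w \<in> carrier_vec (length xs)"
  shows "(res_map xs 2 *\<^sub>v w) $ 0 = - (\<Sum>j<length xs. x_nbhd (xs ! j) * w $ j)"
proof -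
  have "(res_map xs 2 *\<^sub>v w) $ 0 = (\<Sum>j<length xs. res_map xs 2 $$ (0, j) * w $ j)"
    by (rule mat_vec_mult_entry[OF res_map_carrier(3) assms]) simp
  also have "\<dots> = (\<Sum>j<length xs. - (x_nbhd (xs ! j) * w $ j))"
    by (intro sum.cong refl) (simp add: res_map_def)
  finally show ?thesis by (simp add: sum_negf)
qed

lemma res_map_2_mult_Suc:
  assumes "w \<in> carrier_vec (length xs)" "r < length xs"
  shows "(res_map xs 2 *\<^sub>v w) $ Suc r = var (xs ! r) * w $ r"
proof -
  have "(res_map xs 2 *\<^sub>v w) $ Suc r = (\<Sum>j<length xs. res_map xs 2 $$ (Suc r, j) * w $ j)"
    by (rule mat_vec_mult_entry[OF res_map_carrier(3) assms(1)]) (use assms in simp)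
  also have "\<dots> = (\<Sum>j<length xs. if j = r then var (xs ! r) * w $ r else 0)"
    using assms by (intro sum.cong refl) (auto simp: res_map_def)
  also have "\<dots> = var (xs ! r) * w $ r" using assms(2) by simp
  finally show ?thesis .
qed

lemma syzygy:
  assumes "v \<in> C"
  shows "x_cover_off v * var v = x_clique * (x_nbhd v :: ('v, 'k::field) mpoly)"
proof -
  have "indicator_mon (cover_off v) + Poly_Mapping.single v 1 = indicator_mon C + indicator_mon (nbhd v)"
    by (rule poly_mapping_eqI)
      (use assms in \<open>auto simp: lookup_add expo_indicator lookup_single when_def cover_off_def nbhd_def\<close>)
  then show ?thesis by (simp add: var_def mult_single)
qed

lemma cover_ideal_subspace: "ideals.subspace (cover_ideal E :: ('v, 'k::field) mpoly set)"
  unfolding cover_ideal_def by (rule ideals.subspace_span)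

lemma generators_in_cover_ideal:
  "x_clique \<in> (cover_ideal E :: ('v, 'k::field) mpoly set)"
  "v \<in> C \<Longrightarrow> x_cover_off v \<in> (cover_ideal E :: ('v, 'k::field) mpoly set)"
  by (auto simp: cover_ideal_monomial monomial_ideal_def supp_indicator vertex_cover_iff cover_off_def nbhd_def)

text \<open>Surjectivity of the first map onto the cover ideal: the combinations on the right form an
ideal, which contains every monomial whose support is a vertex cover.\<close>

lemma cover_ideal_generated:
  fixes p :: "('v, 'k::field) mpoly"
  assumes xs: "set xs = C" and p: "p \<in> cover_ideal E"
  shows "\<exists>u\<in>carrier_vec (Suc (length xs)). p = x_clique * u $ 0 + (\<Sum>j<length xs. x_cover_off (xs ! j) * u $ Suc j)"
proof -
  define K where "K = {x_clique * u 0 + (\<Sum>j<length xs. x_cover_off (xs ! j) * u (Suc j)) | u :: nat \<Rightarrow> ('v, 'k) mpoly. True}"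
  have KI: "x_clique * u 0 + (\<Sum>j<length xs. x_cover_off (xs ! j) * u (Suc j)) \<in> K" for u
    unfolding K_def by blast
  have K: "ideals.subspace K"
  proof (rule ideals.subspaceI)
    show "0 \<in> K" using KI[of "\<lambda>_. 0"] by simp
  next
    fix a b assume "a \<in> K" "b \<in> K"
    then obtain u u' where "a = x_clique * u 0 + (\<Sum>j<length xs. x_cover_off (xs ! j) * u (Suc j))"
      "b = x_clique * u' 0 + (\<Sum>j<length xs. x_cover_off (xs ! j) * u' (Suc j))" unfolding K_def by blast
    then have "a + b = x_clique * (u 0 + u' 0) + (\<Sum>j<length xs. x_cover_off (xs ! j) * (u (Suc j) + u' (Suc j)))"
      by (simp add: distrib_left sum.distrib)
    then show "a + b \<in> K" using KI[of "\<lambda>j. u j + u' j"] by simp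
  next
    fix c a assume "a \<in> K"
    then obtain u where "a = x_clique * u 0 + (\<Sum>j<length xs. x_cover_off (xs ! j) * u (Suc j))"
      unfolding K_def by blast
    then have "c * a = x_clique * (c * u 0) + (\<Sum>j<length xs. x_cover_off (xs ! j) * (c * u (Suc j)))"
      by (simp add: distrib_left sum_distrib_left mult.left_commute)
    then show "c * a \<in> K" using KI[of "\<lambda>j. c * u j"] by simp
  qed
  have gC: "x_clique \<in> K" using KI[of "\<lambda>j. if j = 0 then 1 else 0"] by simp
  have gG: "x_cover_off v \<in> K" if v: "v \<in> C" for v
  proof -
    obtain i where i: "i < length xs" "xs ! i = v" using v xs by (metis in_set_conv_nth)
    have "(\<Sum>j<length xs. x_cover_off (xs ! j) * (if Suc j = Suc i then 1 else 0))
        = (\<Sum>j<length xs. if j = i then x_cover_off (xs ! i) else 0 :: ('v, 'k) mpoly)"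
      by (intro sum.cong refl) auto
    then show ?thesis using KI[of "\<lambda>j. if j = Suc i then 1 else 0"] i by simp
  qed
  have mono_K: "Poly_Mapping.single m c \<in> K" if "A \<subseteq> supp m" "xpow (indicator_mon A) \<in> K" for m c A
  proof -
    obtain k where "m = indicator_mon A + k" using range_indicator[of m A] \<open>A \<subseteq> supp m\<close> by auto
    then have "Poly_Mapping.single m c = Poly_Mapping.single k c * xpow (indicator_mon A)"
      by (simp add: mult_single add.commute)
    then show ?thesis using ideals.subspace_scale[OF K that(2)] by simp
  qed
  have "p = (\<Sum>m\<in>mons p. Poly_Mapping.single m (coef p m))" by (rule mpoly_expand)
  also have "\<dots> \<in> K"
  proof (rule ideals.subspace_sum[OF K])
    fix m assume "m \<in> mons p"
    then have "vertex_cover E (supp m)" using p by (auto simp: cover_ideal_monomial monomial_ideal_def)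
    then consider "C \<subseteq> supp m" | v where "v \<in> C" "cover_off v \<subseteq> supp m" unfolding vertex_cover_iff by blast
    then show "Poly_Mapping.single m (coef p m) \<in> K"
      by cases (use mono_K gC gG in blast)+
  qed
  finally obtain u where u: "p = x_clique * u 0 + (\<Sum>j<length xs. x_cover_off (xs ! j) * u (Suc j))"
    unfolding K_def by blast
  show ?thesis by (rule bexI[of _ "vec (Suc (length xs)) u"]) (use u in simp_all)
qed

text \<open>In a relation \<open>u\<close> between the generators, the variable of \<open>v \<in> C\<close> divides all generators except
the one of \<open>cover_off v\<close>, so it divides the coefficient of that one. The quotients express \<open>u\<close> in terms of
the basic relations; the coefficient of the generator of \<open>C\<close> is then forced by cancellation.\<close>

lemma res_map_exact_1:
  fixes u :: "('v, 'k::field) mpoly vec"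
  assumes xs: "set xs = C" "distinct xs" and u: "u \<in> carrier_vec (Suc (length xs))"
    and z: "x_clique * u $ 0 + (\<Sum>j<length xs. x_cover_off (xs ! j) * u $ Suc j) = 0"
  shows "u \<in> (*\<^sub>v) (res_map xs 2) ` carrier_vec (length xs)"
proof -
  have div: "\<exists>q. u $ Suc j = var (xs ! j) * q" if j: "j < length xs" for j
  proof -
    let ?v = "xs ! j"
    have v: "?v \<in> C" using xs j by auto
    note P = prime_idealD[OF var_ideal_prime[of "{?v}", where 'k = 'k]]
    have mem: "xpow (indicator_mon A) \<in> (var_ideal {?v} :: ('v, 'k) mpoly set) \<longleftrightarrow> ?v \<in> A" for A
      by (simp add: var_ideal_def monomial_ideal_def supp_indicator)
    have "x_cover_off ?v * u $ Suc j = - (u $ 0 * x_clique + (\<Sum>i\<in>{..<length xs} - {j}. u $ Suc i * x_cover_off (xs ! i)))"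
    proof -
      have *: "b = - (a + c)" if "a + (b + c) = 0" for a b c :: "('v, 'k) mpoly"
        using that unfolding eq_neg_iff_add_eq_0 by (simp only: add.left_commute)
      have "x_clique * u $ 0 + (x_cover_off ?v * u $ Suc j + (\<Sum>i\<in>{..<length xs} - {j}. x_cover_off (xs ! i) * u $ Suc i)) = 0"
        using z j by (subst (asm) sum.remove[of _ j]) auto
      from *[OF this] show ?thesis by (simp only: mult.commute)
    qed
    also have "\<dots> \<in> var_ideal {?v}"
    proof (intro ideals.subspace_neg[OF P(1)] ideals.subspace_add[OF P(1)]
        ideals.subspace_sum[OF P(1)] ideals.subspace_scale[OF P(1)])
      show "x_clique \<in> (var_ideal {?v} :: ('v, 'k) mpoly set)" using v by (simp add: mem)
      fix i assume "i \<in> {..<length xs} - {j}"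
      then have "xs ! i \<noteq> ?v" using xs(2) j by (auto simp: nth_eq_iff_index_eq)
      then show "x_cover_off (xs ! i) \<in> (var_ideal {?v} :: ('v, 'k) mpoly set)" using v by (simp add: mem cover_off_def)
    qed
    finally have "x_cover_off ?v \<in> (var_ideal {?v} :: ('v, 'k) mpoly set) \<or> u $ Suc j \<in> var_ideal {?v}"
      by (rule P(3))
    moreover have "?v \<notin> cover_off ?v" using v by (simp add: cover_off_def nbhd_def)
    ultimately have "u $ Suc j \<in> var_ideal {?v}" unfolding mem by blast
    then show ?thesis
      unfolding var_def var_ideal_def monomial_ideal_def
      by (intro xpow_dvd_of_mons) (auto simp: range_shift_iff lookup_single when_def in_keys_iff Suc_le_eq)
  qed
  then obtain q where q: "\<And>j. j < length xs \<Longrightarrow> u $ Suc j = var (xs ! j) * q j" by metis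
  define w where "w = vec (length xs) q"
  have w: "w \<in> carrier_vec (length xs)" by (simp add: w_def)
  have "(\<Sum>j<length xs. x_cover_off (xs ! j) * u $ Suc j) = (\<Sum>j<length xs. x_clique * (x_nbhd (xs ! j) * w $ j))"
  proof (intro sum.cong refl)
    fix j assume "j \<in> {..<length xs}"
    then have j: "j < length xs" "xs ! j \<in> C" using xs by auto
    then show "x_cover_off (xs ! j) * u $ Suc j = x_clique * (x_nbhd (xs ! j) * w $ j)"
      using syzygy[OF j(2), where 'k = 'k] by (simp add: q w_def flip: mult.assoc)
  qed
  then have "x_clique * (u $ 0 + (\<Sum>j<length xs. x_nbhd (xs ! j) * w $ j)) = x_clique * 0"
    using z by (simp add: distrib_left sum_distrib_left)
  then have u0: "u $ 0 = - (\<Sum>j<length xs. x_nbhd (xs ! j) * w $ j)"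
    unfolding xpow_mult_cancel by (simp add: eq_neg_iff_add_eq_0)
  have "res_map xs 2 *\<^sub>v w = u"
  proof (rule eq_vecI)
    fix i assume "i < dim_vec u"
    then have i: "i < Suc (length xs)" using u by simp
    show "(res_map xs 2 *\<^sub>v w) $ i = u $ i"
    proof (cases i)
      case 0
      then show ?thesis using res_map_2_mult_0[OF w] u0 by simp
    next
      case (Suc r)
      then have "r < length xs" using i by simp
      then show ?thesis using res_map_2_mult_Suc[OF w] q Suc by (simp add: w_def)
    qed
  qed (use u res_map_carrier(3)[of xs] in auto)
  then show ?thesis using w by blast
qed

lemma res_map_complex_1:
  fixes w :: "('v, 'k::field) mpoly vec"
  assumes xs: "set xs = C" and w: "w \<in> carrier_vec (length xs)"
  shows "(res_map xs 1 *\<^sub>v (res_map xs 2 *\<^sub>v w)) $ 0 = 0"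
proof -
  have "res_map xs 2 *\<^sub>v w \<in> carrier_vec (Suc (length xs))" by (rule mult_mat_vec_carrier[OF res_map_carrier(3) w])
  then have "(res_map xs 1 *\<^sub>v (res_map xs 2 *\<^sub>v w)) $ 0
      = x_clique * (- (\<Sum>j<length xs. x_nbhd (xs ! j) * w $ j))
        + (\<Sum>j<length xs. x_cover_off (xs ! j) * (var (xs ! j) * w $ j))"
    by (simp only: res_map_1_mult res_map_2_mult_0[OF w])
      (auto intro!: sum.cong simp: res_map_2_mult_Suc[OF w])
  also have "(\<Sum>j<length xs. x_cover_off (xs ! j) * (var (xs ! j) * w $ j))
      = (\<Sum>j<length xs. x_clique * (x_nbhd (xs ! j) * w $ j))"
  proof (intro sum.cong refl)
    fix j assume "j \<in> {..<length xs}"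
    then have "xs ! j \<in> C" using xs by auto
    from syzygy[OF this, where 'k = 'k]
    show "x_cover_off (xs ! j) * (var (xs ! j) * w $ j) = x_clique * (x_nbhd (xs ! j) * w $ j)"
      by (simp flip: mult.assoc)
  qed
  finally show ?thesis by (simp add: sum_distrib_left)
qed

proposition cover_ideal_resolution:
  assumes xs: "set xs = C" "distinct xs"
  shows "graded_free_resolution (cover_ideal E :: ('v, 'k::field) mpoly set) (res_degrees xs) (res_map xs)"
proof -
  let ?J = "cover_ideal E :: ('v, 'k) mpoly set" and ?l = "length xs"
  have J: "ideals.subspace ?J" by (rule cover_ideal_subspace)
  have len: "length (res_degrees xs 0) = 1" "length (res_degrees xs 1) = Suc ?l" "length (res_degrees xs 2) = ?l"
    "\<And>i. i \<ge> 3 \<Longrightarrow> length (res_degrees xs i) = 0"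
    by (simp_all add: res_degrees_def)
  have cases3: "i = 0 \<or> i = 1 \<or> i \<ge> 2" for i :: nat by linarith
  have carr: "(res_map xs (Suc i) :: ('v, 'k) mpoly mat)
      \<in> carrier_mat (length (res_degrees xs i)) (length (res_degrees xs (Suc i)))" for i
    using cases3[of i] res_map_carrier(2,3)[of xs] res_map_carrier(4)[of "Suc i" xs] len
    by (auto simp: numeral_2_eq_2)
  have homog0: "homogeneous (res_degrees xs 0 ! c) (res_map xs 0 $$ (0, c) :: ('v, 'k) mpoly)"
    if "c < length (res_degrees xs 0)" for c
    using that by (simp add: res_degrees_def res_map_def homogeneous_def mon_degree_0)
  have homog: "homogeneous (res_degrees xs (Suc i) ! c - res_degrees xs i ! r)
      (res_map xs (Suc i) $$ (r, c) :: ('v, 'k) mpoly)"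
    if r: "r < length (res_degrees xs i)" and c: "c < length (res_degrees xs (Suc i))" for i r c
  proof -
    have "\<not> Suc i \<ge> 3" using c len(4)[of "Suc i"] by auto
    then consider "i = 0" | "i = 1" by linarith
    then show ?thesis
    proof cases
      case 1
      have "xs ! j \<in> C" if "j < ?l" for j using that xs by auto
      then show ?thesis using 1 r c
        by (cases c) (auto simp: res_degrees_def res_map_def homogeneous_def mon_degree_indicator card_cover_off)
    next
      case 2
      then have c': "c < ?l" "r < Suc ?l" using c r len by (auto simp: numeral_2_eq_2)
      show ?thesis
      proof (cases r)
        case 0
        then show ?thesis using 2 c'
          by (simp add: res_degrees_def res_map_def homogeneous_def mon_degree_indicator)
      next
        case (Suc r')
        then show ?thesis using 2 c' card_C_pos
          by (auto simp: res_degrees_def res_map_def homogeneous_def var_def mon_degree_single)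
      qed
    qed
  qed
  have surj: "\<exists>w\<in>carrier_vec (length (res_degrees xs 0)). p - (res_map xs 0 *\<^sub>v w) $ 0 \<in> ?J" for p
    by (rule bexI[of _ "vec 1 (\<lambda>_. p)"])
      (auto simp: len res_map_def scalar_prod_def ideals.subspace_0[OF J])
  have D0: "(res_map xs 0 *\<^sub>v w) $ 0 = w $ 0" if "w \<in> carrier_vec 1" for w :: "('v, 'k) mpoly vec"
    using that by (simp add: res_map_def scalar_prod_def)
  have ex0: "{w \<in> carrier_vec (length (res_degrees xs 0)). (res_map xs 0 *\<^sub>v w) $ 0 \<in> ?J}
       = (*\<^sub>v) (res_map xs 1) ` carrier_vec (length (res_degrees xs 1))"
  proof (rule Set.set_eqI, rule iffI)
    fix w assume "w \<in> {w \<in> carrier_vec (length (res_degrees xs 0)). (res_map xs 0 *\<^sub>v w) $ 0 \<in> ?J}"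
    then have w: "w \<in> carrier_vec 1" "w $ 0 \<in> ?J" using D0 by (auto simp: len)
    obtain u where u: "u \<in> carrier_vec (Suc ?l)"
      "w $ 0 = x_clique * u $ 0 + (\<Sum>j<?l. x_cover_off (xs ! j) * u $ Suc j)"
      using cover_ideal_generated[OF xs(1) w(2)] by blast
    have "res_map xs 1 *\<^sub>v u = w"
    proof (rule eq_vecI)
      fix i assume "i < dim_vec w"
      then have "i = 0" using w by simp
      then show "(res_map xs 1 *\<^sub>v u) $ i = w $ i" using u(2) res_map_1_mult[OF u(1)] by simp
    qed (use w res_map_carrier(2)[of xs] in auto)
    then show "w \<in> (*\<^sub>v) (res_map xs 1) ` carrier_vec (length (res_degrees xs 1))"
      using u(1) unfolding len by blast
  next
    fix w :: "('v, 'k) mpoly vec" assume "w \<in> (*\<^sub>v) (res_map xs 1) ` carrier_vec (length (res_degrees xs 1))"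
    then obtain u :: "('v, 'k) mpoly vec"
      where u: "u \<in> carrier_vec (Suc ?l)" "w = res_map xs 1 *\<^sub>v u" unfolding len by blast
    have w: "w \<in> carrier_vec 1"
      unfolding u(2) by (rule mult_mat_vec_carrier[OF res_map_carrier(2) u(1)])
    have "w $ 0 = u $ 0 * x_clique + (\<Sum>j<?l. u $ Suc j * x_cover_off (xs ! j))"
      unfolding u(2) res_map_1_mult[OF u(1)] by (simp add: mult.commute)
    also have "\<dots> \<in> ?J"
      using xs(1)
      by (intro ideals.subspace_add[OF J] ideals.subspace_sum[OF J] ideals.subspace_scale[OF J]
          generators_in_cover_ideal) auto
    finally show "w \<in> {w \<in> carrier_vec (length (res_degrees xs 0)). (res_map xs 0 *\<^sub>v w) $ 0 \<in> ?J}"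
      using w D0[OF w] by (simp add: len)
  qed
  have ex: "mat_kernel (res_map xs (Suc i) :: ('v, 'k) mpoly mat)
       = (*\<^sub>v) (res_map xs (Suc (Suc i))) ` carrier_vec (length (res_degrees xs (Suc (Suc i))))" for i
  proof -
    consider "i = 0" | "i = 1" | "i \<ge> 2" by linarith
    then show ?thesis
    proof cases
      case 1
      have "mat_kernel (res_map xs 1 :: ('v, 'k) mpoly mat) = (*\<^sub>v) (res_map xs 2) ` carrier_vec ?l"
      proof (rule Set.set_eqI, rule iffI)
        fix u :: "('v, 'k) mpoly vec" assume "u \<in> mat_kernel (res_map xs 1)"
        from mat_kernelD[OF res_map_carrier(2) this]
        have u: "u \<in> carrier_vec (Suc ?l)" "res_map xs 1 *\<^sub>v u = 0\<^sub>v 1" by auto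
        then have "(res_map xs 1 *\<^sub>v u) $ 0 = 0" by simp
        then show "u \<in> (*\<^sub>v) (res_map xs 2) ` carrier_vec ?l"
          unfolding res_map_1_mult[OF u(1)] by (rule res_map_exact_1[OF xs u(1)])
      next
        fix u :: "('v, 'k) mpoly vec" assume "u \<in> (*\<^sub>v) (res_map xs 2) ` carrier_vec ?l"
        then obtain w where w: "w \<in> carrier_vec ?l" "u = res_map xs 2 *\<^sub>v w" by blast
        have u: "u \<in> carrier_vec (Suc ?l)"
          unfolding w(2) by (rule mult_mat_vec_carrier[OF res_map_carrier(3) w(1)])
        have "res_map xs 1 *\<^sub>v u = 0\<^sub>v 1"
          by (rule eq_vecI) (use res_map_complex_1[OF xs(1) w(1)] res_map_carrier(2)[of xs] w(2) in auto)
        then show "u \<in> mat_kernel (res_map xs 1)"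
          by (rule mat_kernelI[OF res_map_carrier(2) u])
      qed
      then show ?thesis using 1 len(3) by (simp add: numeral_2_eq_2)
    next
      case 2
      have "mat_kernel (res_map xs 2 :: ('v, 'k) mpoly mat) = (*\<^sub>v) (res_map xs 3) ` carrier_vec 0"
      proof (rule mat_kernel_trivial[OF res_map_carrier(3)])
        show "(res_map xs 3 :: ('v, 'k) mpoly mat) \<in> carrier_mat ?l 0"
          using res_map_carrier(4)[of 3 xs] len by simp
      next
        fix w :: "('v, 'k) mpoly vec"
        assume w: "w \<in> carrier_vec ?l" "res_map xs 2 *\<^sub>v w = 0\<^sub>v (Suc ?l)"
        show "w = 0\<^sub>v ?l"
        proof (rule eq_vecI)
          fix j assume "j < dim_vec (0\<^sub>v ?l :: ('v, 'k) mpoly vec)"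
          then have j: "j < ?l" by simp
          then have "var (xs ! j) * w $ j = var (xs ! j) * 0"
            using res_map_2_mult_Suc[OF w(1) j] w(2) by simp
          then have "w $ j = 0" unfolding var_def xpow_mult_cancel .
          then show "w $ j = 0\<^sub>v ?l $ j" using j by simp
        qed (use w in auto)
      qed
      then show ?thesis using 2 len(4) by (simp add: numeral_2_eq_2 numeral_3_eq_3)
    next
      case 3
      have "mat_kernel (res_map xs (Suc i) :: ('v, 'k) mpoly mat)
          = (*\<^sub>v) (res_map xs (Suc (Suc i))) ` carrier_vec 0"
      proof (rule mat_kernel_trivial)
        show "res_map xs (Suc i) \<in> carrier_mat (length (res_degrees xs i)) 0"
          using res_map_carrier(4)[of "Suc i" xs] 3 by simp
        show "res_map xs (Suc (Suc i)) \<in> carrier_mat 0 0"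
          using res_map_carrier(4)[of "Suc (Suc i)" xs] 3 len(4)[of "Suc i"] by simp
      qed auto
      then show ?thesis using 3 len(4) by simp
    qed
  qed
  show ?thesis
    unfolding graded_free_resolution_def
    using res_map_carrier(1) carr homog0 homog surj ex0 ex len(1) by auto
qed

lemma cover_ideal_resolution_minimal:
  assumes xs: "set xs = C" "distinct xs"
  shows "minimal_free_resolution (cover_ideal E :: ('v, 'k::field) mpoly set) (res_degrees xs) (res_map xs)"
  unfolding minimal_free_resolution_def
proof (intro conjI allI impI cover_ideal_resolution[OF xs])
  fix i r c
  assume r: "r < length (res_degrees xs i)" and c: "c < length (res_degrees xs (Suc i))"
  have z: "indicator_mon A \<noteq> 0" if "A \<noteq> {}" for A :: "'v set"
    using that supp_indicator[of A] by auto
  have nz: "xs ! j \<in> C" "nbhd (xs ! j) \<noteq> {}" "cover_off (xs ! j) \<noteq> {}" if "j < length xs" for j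
  proof -
    show v: "xs ! j \<in> C" using that xs by auto
    then show "nbhd (xs ! j) \<noteq> {}" using card_nbhd_pos[OF v] by auto
    then show "cover_off (xs ! j) \<noteq> {}" by (simp add: cover_off_def)
  qed
  have "\<not> Suc i \<ge> 3" using c by (auto simp: res_degrees_def)
  then consider "i = 0" | "i = 1" by linarith
  then show "coef (res_map xs (Suc i) $$ (r, c) :: ('v, 'k) mpoly) 0 = 0"
  proof cases
    case 1
    then show ?thesis using r c z[OF nonempty] z nz
      by (cases c) (auto simp: res_degrees_def res_map_def lookup_single)
  next
    case 2
    then have c': "c < length xs" "r < Suc (length xs)" using c r by (simp_all add: res_degrees_def)
    have "Poly_Mapping.single v (1::nat) \<noteq> 0" for v :: 'v
      using lookup_single_eq[of v "1::nat"] by (metis lookup_zero zero_neq_one)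
    then show ?thesis using 2 c' z[OF nz(2)[OF c'(1)]]
      by (cases r) (auto simp: res_map_def lookup_single var_def)
  qed
qed

text \<open>The twists \<open>0\<close>, \<open>c\<close>, \<open>c - 1 + d v\<close> and \<open>c + d v\<close> occur in homological degrees \<open>0\<close>, \<open>1\<close>, \<open>1\<close> and
\<open>2\<close>, where \<open>d v\<close> is the size of \<open>nbhd v\<close>. The last two contribute \<open>c + d v - 2\<close>, which is at
least \<open>0\<close> and \<open>c - 1\<close> because \<open>c \<ge> 1\<close> and \<open>d v \<ge> 1\<close>.\<close>

proposition regularity_cover:
  "regularity (cover_ideal E :: ('v, 'k::field) mpoly set) = int (card C) + int dmax - 2"
proof -
  let ?J = "cover_ideal E :: ('v, 'k) mpoly set"
  obtain xs where xs: "set xs = C" "distinct xs" using finite_distinct_list[of C] by auto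
  have hJ: "hom_component e p \<in> ?J" if "p \<in> ?J" for e p
    using that by (auto simp: cover_ideal_monomial monomial_ideal_def in_keys_iff coef_hom_component when_def
        split: if_splits)
  have "graded_betti ?J i j = count_list (res_degrees xs i) j" for i j
    by (rule graded_betti_eq_count[OF cover_ideal_resolution_minimal[OF xs] cover_ideal_subspace hJ])
  then have set: "{j - int i | i j. graded_betti ?J i j \<noteq> 0} = {j - int i | i j. j \<in> set (res_degrees xs i)}"
    by (simp add: count_list_0_iff)
  have c1: "card C \<ge> 1" and d1: "dmax \<ge> 1" by (rule card_C_pos dmax_pos)+
  have "Max {j - int i | i j. j \<in> set (res_degrees xs i)} = int (card C) + int dmax - 2"
  proof (rule Max_eqI)
    have "{j - int i | i j. j \<in> set (res_degrees xs i)} \<subseteq> (\<Union>i\<in>{..2}. (\<lambda>j. j - int i) ` set (res_degrees xs i))"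
      by (force simp: res_degrees_def split: if_splits)
    then show "finite {j - int i | i j. j \<in> set (res_degrees xs i)}" by (rule finite_subset) auto
  next
    fix y assume "y \<in> {j - int i | i j. j \<in> set (res_degrees xs i)}"
    then obtain i j where y: "y = j - int i" "j \<in> set (res_degrees xs i)" by blast
    then consider "y = 0" | "y = int (card C) - 1"
      | v where "v \<in> C" "y = int (card C - 1 + card (nbhd v)) - 1"
      | v where "v \<in> C" "y = int (card C + card (nbhd v)) - 2"
      using xs by (auto simp: res_degrees_def split: if_splits)
    then show "y \<le> int (card C) + int dmax - 2"
    proof cases
      case (3 v)
      then show ?thesis using card_nbhd_le_dmax[of v] c1 by simp
    next
      case (4 v)
      then show ?thesis using card_nbhd_le_dmax[of v] by simp
    qed (use c1 d1 in auto)
  next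
    obtain v where "v \<in> C" "card (nbhd v) = dmax" using dmax_attained by blast
    then have "int (card C + dmax) \<in> (\<lambda>v. int (card C + card (nbhd v))) ` C"
      by (intro image_eqI[of _ _ v]) simp_all
    then have "int (card C + dmax) \<in> set (res_degrees xs 2)" by (simp add: res_degrees_def xs(1))
    then show "int (card C) + int dmax - 2 \<in> {j - int i | i j. j \<in> set (res_degrees xs i)}"
      by (intro CollectI exI[of _ 2] exI[of _ "int (card C + dmax)"]) simp
  qed
  then show ?thesis unfolding regularity_def set .
qed

end

section \<open>Values attained by connected split graphs\<close>

lemma graph_connected_neighbour:
  fixes E :: "'v::finite set set"
  assumes conn: "graph_connected E" and two: "card (UNIV :: 'v set) \<ge> 2"
  shows "\<exists>w. {u, w} \<in> E"
proof -
  have "\<exists>w. w \<noteq> u"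
  proof (rule ccontr)
    assume "\<not> (\<exists>w. w \<noteq> u)"
    then have "(UNIV :: 'v set) = {u}" by auto
    then have "card (UNIV :: 'v set) = card {u}" by (rule arg_cong)
    then show False using two by simp
  qed
  then obtain w where w: "w \<noteq> u" by blast
  have "(u, w) \<in> {(a, b). {a, b} \<in> E}\<^sup>*" using conn unfolding graph_connected_def by blast
  then show ?thesis
  proof (cases rule: converse_rtranclE)
    case (step y)
    then show ?thesis by auto
  qed (use w in simp)
qed

text \<open>If \<open>v0\<close> in the clique has no neighbour outside, move it to the independent side. Every
remaining clique vertex then has \<open>v0\<close> as a neighbour there, so one move suffices. Connectedness
keeps the clique nonempty and gives every outside vertex a neighbour in it.\<close>

lemma split_partition_exists:
  fixes E :: "'v::finite set set"
  assumes simple: "simple_graph E" and conn: "graph_connected E" and split: "split_graph E"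
    and two: "card (UNIV :: 'v set) \<ge> 2"
  shows "\<exists>C. split_partition E C \<and> (\<forall>u. u \<notin> C \<longrightarrow> (\<exists>v\<in>C. {v, u} \<in> E))"
proof -
  obtain C0 I0 where C0I0: "C0 \<union> I0 = UNIV" "C0 \<inter> I0 = {}"
    "\<forall>u\<in>C0. \<forall>v\<in>C0. u \<noteq> v \<longrightarrow> {u, v} \<in> E" "\<forall>u\<in>I0. \<forall>v\<in>I0. {u, v} \<notin> E"
    using split unfolding split_graph_def by (elim exE conjE)
  have cl0: "{u, v} \<in> E" if "u \<in> C0" "v \<in> C0" "u \<noteq> v" for u v using C0I0(3) that by blast
  have ind0: "{u, v} \<notin> E" if "u \<notin> C0" "v \<notin> C0" for u v using C0I0(1,4) that by blast
  have loop: "{v, v} \<notin> E" for v using simple by (auto simp: simple_graph_def)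
  note nbr = graph_connected_neighbour[OF conn two]
  have dominated: "\<exists>v\<in>C. {v, u} \<in> E"
    if "\<And>u v. u \<notin> C \<Longrightarrow> v \<notin> C \<Longrightarrow> {u, v} \<notin> E" "u \<notin> C" for C u
  proof -
    obtain w where w: "{u, w} \<in> E" using nbr by blast
    then have "w \<in> C" using that by blast
    then show ?thesis using w by (auto simp: insert_commute)
  qed
  show ?thesis
  proof (cases "\<exists>v0\<in>C0. \<forall>u. u \<notin> C0 \<longrightarrow> {v0, u} \<notin> E")
    case False
    have "split_partition E C0"
    proof
      show "C0 \<noteq> {}" using nbr ind0 by blast
    qed (use simple cl0 ind0 False in auto)
    then show ?thesis using dominated[OF ind0] by blast
  next
    case True
    then obtain v0 where v0: "v0 \<in> C0" "\<And>u. u \<notin> C0 \<Longrightarrow> {v0, u} \<notin> E" by blast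
    let ?C = "C0 - {v0}"
    have ind: "{u, v} \<notin> E" if "u \<notin> ?C" "v \<notin> ?C" for u v
      using that ind0[of u v] v0(2)[of u] v0(2)[of v] loop[of v0] by (auto simp: insert_commute)
    have "split_partition E ?C"
    proof
      obtain w where w: "{v0, w} \<in> E" using nbr by blast
      then have "w \<in> C0" "w \<noteq> v0" using v0(2) loop by auto
      then show "?C \<noteq> {}" by blast
      fix v assume "v \<in> ?C"
      then show "\<exists>u. u \<notin> ?C \<and> {v, u} \<in> E" using cl0[of v v0] v0(1) by auto
    qed (use simple cl0 ind in auto)
    then show ?thesis using dominated[OF ind] by blast
  qed
qed

lemma q_min_le:
  assumes "1 \<le> c" "c \<le> n - 1" "n \<le> c * (d + 1)"
  shows "q_min n \<le> int c + int d - 2"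
proof -
  have "\<lceil>of_nat n / of_int (int c) :: rat\<rceil> \<le> int d + 1"
  proof (rule ceiling_le)
    have "(of_nat n :: rat) \<le> of_nat (c * (d + 1))" using assms(3) by (rule of_nat_mono)
    then show "(of_nat n / of_int (int c) :: rat) \<le> of_int (int d + 1)"
      using assms(1) by (simp add: divide_le_eq field_simps)
  qed
  then have "int c + \<lceil>of_nat n / of_int (int c) :: rat\<rceil> - 3 \<le> int c + int d - 2" by simp
  moreover have "q_min n \<le> int c + \<lceil>of_nat n / of_int (int c) :: rat\<rceil> - 3"
    unfolding q_min_def
  proof (rule Min_le)
    show "int c + \<lceil>of_nat n / of_int (int c) :: rat\<rceil> - 3
        \<in> (\<lambda>c::int. c + \<lceil>of_nat n / of_int c :: rat\<rceil> - 3) ` {1..int n - 1}"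
      using assms(1,2) by (intro image_eqI[of _ _ "int c"] refl) auto
  qed simp
  ultimately show ?thesis by simp
qed

text \<open>For the minimising \<open>c\<close>, a value \<open>c + d - 2\<close> no less than the minimum leaves room for
\<open>c\<close> neighbourhoods of size \<open>d\<close> to cover \<open>n - c\<close> vertices; and \<open>d \<ge> 1\<close> because \<open>c < n\<close>.\<close>

lemma q_min_attained:
  assumes "n \<ge> 2"
  obtains c where "1 \<le> c" "c \<le> n - 1"
    "\<And>d. q_min n \<le> int c + int d - 2 \<Longrightarrow> d \<ge> 1 \<and> n \<le> c * (d + 1)"
    "q_min n \<ge> int c - 1"
proof -
  have "q_min n \<in> (\<lambda>c::int. c + \<lceil>of_nat n / of_int c :: rat\<rceil> - 3) ` {1..int n - 1}"
    unfolding q_min_def using assms by (intro Min_in) auto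
  then obtain c' :: int where c': "1 \<le> c'" "c' \<le> int n - 1"
    "q_min n = c' + \<lceil>of_nat n / of_int c' :: rat\<rceil> - 3" by auto
  define c where "c = nat c'"
  have c: "c' = int c" "1 \<le> c" "c \<le> n - 1" using c' by (auto simp: c_def)
  have "(1 :: rat) < of_nat n / of_nat c" using c assms by (simp add: less_divide_eq)
  then have two: "\<lceil>of_nat n / of_nat c :: rat\<rceil> \<ge> 2" by linarith
  show ?thesis
  proof
    show "1 \<le> c" "c \<le> n - 1" by fact+
    show "q_min n \<ge> int c - 1" using c'(3) two c(1) by simp
    fix d assume "q_min n \<le> int c + int d - 2"
    then have d: "\<lceil>of_nat n / of_nat c :: rat\<rceil> \<le> int d + 1" using c'(3) c(1) by simp
    then have "(of_nat n / of_nat c :: rat) \<le> of_int (int d + 1)" by (simp only: ceiling_le_iff)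
    then have "(of_nat n :: rat) \<le> of_nat (c * (d + 1))"
      using c(2) by (simp add: divide_le_eq field_simps)
    then have "n \<le> c * (d + 1)" by (simp only: of_nat_le_iff)
    moreover have "d \<ge> 1" using d two by linarith
    ultimately show "d \<ge> 1 \<and> n \<le> c * (d + 1)" by blast
  qed
qed

text \<open>Number the vertices such that the clique consists of the first \<open>c\<close> of them. Clique vertex \<open>j\<close> is
joined to the window of \<open>d\<close> outside vertices that starts at \<open>j * d\<close>, moved left where it would
overrun the end. All windows have size exactly \<open>d\<close>, and since \<open>n - c \<le> c * d\<close> they cover the outside: the
\<open>k\<close>-th outside vertex lies in window \<open>k div d\<close>.\<close>

lemma window_graph_exists:
  assumes n: "card (UNIV :: 'v::finite set) = n" and c: "1 \<le> c" "c \<le> n - 1"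
    and d: "1 \<le> d" "d \<le> n - c" "n \<le> c * (d + 1)"
  shows "\<exists>(E :: 'v set set) C. graph_connected E \<and> split_graph E \<and> split_partition E C
           \<and> card C = c \<and> split_partition.dmax E C = d"
proof -
  define r where "r = n - c"
  define a where "a j = min (j * d) (r - d)" for j
  have cn: "c < n" "c + r = n" using c by (auto simp: r_def)
  have ar: "a j + d \<le> r" for j using d(2) by (auto simp: a_def r_def min_def)
  obtain e where e: "bij_betw e {0..<n} (UNIV :: 'v set)"
    using ex_bij_betw_nat_finite[of "UNIV :: 'v set"] n by auto
  have e_inj: "e x = e y \<longleftrightarrow> x = y" if "x < n" "y < n" for x y
    using bij_betw_imp_inj_on[OF e] that by (auto simp: inj_on_def)
  have e_surj: "\<exists>x<n. u = e x" for u
  proof -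
    have "u \<in> e ` {0..<n}" using bij_betw_imp_surj_on[OF e] by simp
    then show ?thesis by auto
  qed
  define R where "R x y \<longleftrightarrow> x < y \<and> y < n \<and> (y < c \<or> x < c \<and> a x \<le> y - c \<and> y - c < a x + d)" for x y
  define E where "E = {{e x, e y} | x y. R x y}"
  define C where "C = e ` {0..<c}"
  have edge: "{e x, e y} \<in> E \<longleftrightarrow> R x y \<or> R y x" if "x < n" "y < n" for x y
  proof
    assume "{e x, e y} \<in> E"
    then obtain x' y' where xy: "{e x, e y} = {e x', e y'}" "R x' y'" unfolding E_def by blast
    then have "x' < n" "y' < n" by (auto simp: R_def)
    then show "R x y \<or> R y x" using xy that by (auto simp: doubleton_eq_iff e_inj)
  next
    assume "R x y \<or> R y x"
    moreover have "{e y, e x} = {e x, e y}" by (rule insert_commute)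
    ultimately show "{e x, e y} \<in> E" unfolding E_def mem_Collect_eq by metis
  qed
  have C: "e x \<in> C \<longleftrightarrow> x < c" if "x < n" for x
    using that cn e_inj by (auto simp: C_def)
  have simple: "simple_graph E"
    unfolding simple_graph_def
  proof
    fix s assume "s \<in> E"
    then obtain x y where "s = {e x, e y}" "R x y" unfolding E_def by blast
    then show "card s = 2" using e_inj[of x y] by (auto simp: R_def)
  qed
  have clique: "{u, v} \<in> E" if uv: "u \<in> C" "v \<in> C" "u \<noteq> v" for u v
  proof -
    obtain x y where xy: "x < n" "u = e x" "y < n" "v = e y" using e_surj[of u] e_surj[of v] by blast
    then have "x < c" "y < c" "x \<noteq> y" using uv C by auto
    then show ?thesis using xy by (auto simp: edge R_def)
  qed
  have indep: "{u, v} \<notin> E" if uv: "u \<notin> C" "v \<notin> C" for u v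
  proof -
    obtain x y where xy: "x < n" "u = e x" "y < n" "v = e y" using e_surj[of u] e_surj[of v] by blast
    then have "\<not> x < c" "\<not> y < c" using uv C by auto
    then show ?thesis using xy by (auto simp: edge R_def)
  qed
  have nbrs: "{u. u \<notin> C \<and> {e x, u} \<in> E} = e ` {c + a x..<c + a x + d}" if x: "x < c" for x
  proof (intro equalityI subsetI)
    fix u assume "u \<in> {u. u \<notin> C \<and> {e x, u} \<in> E}"
    then have u: "u \<notin> C" "{e x, u} \<in> E" by auto
    obtain y where y: "y < n" "u = e y" using e_surj by blast
    then have yc: "\<not> y < c" using u(1) C by simp
    have "R x y \<or> R y x" using edge[of x y] u(2) y x cn by simp
    then have "a x \<le> y - c" "y - c < a x + d" using x yc by (auto simp: R_def)
    then have "y \<in> {c + a x..<c + a x + d}" using yc by auto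
    then show "u \<in> e ` {c + a x..<c + a x + d}" using y(2) by blast
  next
    fix u assume "u \<in> e ` {c + a x..<c + a x + d}"
    then obtain y where y: "u = e y" "c + a x \<le> y" "y < c + a x + d" by auto
    have yn: "y < n" using y(3) ar[of x] cn(2) by linarith
    have "R x y" using x y yn by (auto simp: R_def)
    then show "u \<in> {u. u \<notin> C \<and> {e x, u} \<in> E}" using y yn x cn edge[of x y] C[of y] by auto
  qed
  have card_nbrs: "card {u. u \<notin> C \<and> {v, u} \<in> E} = d" if v: "v \<in> C" for v
  proof -
    obtain x where x: "x < c" "v = e x" using v by (auto simp: C_def)
    have "inj_on e {c + a x..<c + a x + d}"
      by (rule inj_on_subset[OF bij_betw_imp_inj_on[OF e]]) (use ar[of x] cn(2) in auto)
    then show ?thesis unfolding x(2) nbrs[OF x(1)] by (simp add: card_image)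
  qed
  interpret split_partition E C
  proof
    show "C \<noteq> {}" using c(1) by (simp add: C_def)
    fix v assume "v \<in> C"
    then have "card {u. u \<notin> C \<and> {v, u} \<in> E} \<noteq> 0" using card_nbrs d(1) by simp
    then show "\<exists>u. u \<notin> C \<and> {v, u} \<in> E" by (metis (mono_tags, lifting) Collect_empty_eq card.empty)
  qed (use simple clique indep in auto)
  have "card (nbhd v) = d" if "v \<in> C" for v using card_nbrs[OF that] by (simp add: nbhd_def)
  then have dm: "dmax = d" using dmax_attained by auto
  have "card C = c"
    unfolding C_def using inj_on_subset[OF bij_betw_imp_inj_on[OF e], of "{0..<c}"] cn(1)
    by (simp add: card_image)
  moreover have "split_graph E"
    unfolding split_graph_def
    by (rule exI[of _ C], rule exI[of _ "- C"]) (use clique indep in auto)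
  moreover have "graph_connected E"
  proof -
    let ?r = "{(a, b). {a, b} \<in> E}"
    have "sym ?r" by (auto simp: sym_def insert_commute)
    then have symr: "(x, y) \<in> ?r\<^sup>* \<Longrightarrow> (y, x) \<in> ?r\<^sup>*" for x y using sym_rtrancl symD by metis
    have clique_root: "(e x, e 0) \<in> ?r\<^sup>*" if "x < c" for x
    proof (cases "x = 0")
      case False
      then have "R 0 x" using that cn by (auto simp: R_def)
      then have "{e x, e 0} \<in> E" using edge[of x 0] that cn by simp
      then show ?thesis by blast
    qed simp
    have root: "(u, e 0) \<in> ?r\<^sup>*" for u
    proof -
      obtain y where y: "y < n" "u = e y" using e_surj by blast
      show ?thesis
      proof (cases "y < c")
        case True
        then show ?thesis using clique_root y by simp
      next
        case False
        define k where "k = y - c"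
        define x where "x = k div d"
        have k: "k < r" "y = c + k" using False y cn by (auto simp: k_def)
        have "r \<le> c * d" using d(3) cn(2) by simp
        then have x: "x < c" unfolding x_def using k(1) d(1) by (intro less_mult_imp_div_less) simp
        have "k = x * d + k mod d" "k mod d < d" unfolding x_def using d(1) by simp_all
        then have "x * d \<le> k" "k < x * d + d" by linarith+
        then have "a x \<le> k" "k < a x + d" using k(1) ar[of x] by (auto simp: a_def min_def)
        then have "R x y" using x k(2) y(1) by (auto simp: R_def)
        then have "{u, e x} \<in> E" using edge[of y x] x y cn by simp
        then have "(u, e x) \<in> ?r" by simp
        then show ?thesis using clique_root[OF x] by (rule converse_rtrancl_into_rtrancl)
      qed
    qed
    show ?thesis
      unfolding graph_connected_def by (intro allI rtrancl_trans[OF root symr[OF root]])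
  qed
  ultimately show ?thesis using dm split_partition_axioms by blast
qed

theorem theorem8p10:
  fixes n :: nat
  assumes "n \<ge> 2" and "card (UNIV :: 'v::finite set) = n"
  shows "{(regularity (cover_ideal E :: ('v::finite, 'k::field) mpoly set),
           int (Polynomial.degree (h_polynomial (cover_ideal E :: ('v, 'k) mpoly set)))) | E :: 'v set set.
           simple_graph E \<and> graph_connected E \<and> split_graph E}
       = {(q, q) | q :: int. q_min n \<le> q \<and> q \<le> int n - 2}"
proof (intro equalityI subsetI)
  fix z assume "z \<in> {(regularity (cover_ideal E :: ('v, 'k) mpoly set),
           int (Polynomial.degree (h_polynomial (cover_ideal E :: ('v, 'k) mpoly set)))) | E :: 'v set set.
           simple_graph E \<and> graph_connected E \<and> split_graph E}"
  then obtain E :: "'v set set" where z: "z = (regularity (cover_ideal E :: ('v, 'k) mpoly set),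
           int (Polynomial.degree (h_polynomial (cover_ideal E :: ('v, 'k) mpoly set))))"
    and E: "simple_graph E" "graph_connected E" "split_graph E" by blast
  obtain C where C: "split_partition E C" and dom: "\<And>u. u \<notin> C \<Longrightarrow> \<exists>v\<in>C. {v, u} \<in> E"
    using split_partition_exists[OF E] assms by blast
  interpret split_partition E C by (rule C)
  have "z = (int (card C) + int dmax - 2, int (card C) + int dmax - 2)"
    unfolding z regularity_cover degree_h_polynomial_cover ..
  moreover have "int (card C) + int dmax - 2 \<le> int n - 2"
  proof -
    obtain v where v: "v \<in> C" "card (nbhd v) = dmax" using dmax_attained by blast
    have "card C + card (nbhd v) = card (C \<union> nbhd v)" by (subst card_Un_disjoint) (auto simp: nbhd_def)
    also have "\<dots> \<le> n" unfolding assms(2)[symmetric] by (rule card_mono) auto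
    finally show ?thesis using v(2) by simp
  qed
  moreover have "q_min n \<le> int (card C) + int dmax - 2"
  proof (rule q_min_le)
    show "1 \<le> card C" by (rule card_C_pos)
    obtain v u where "u \<notin> C" using nonempty has_nbr by blast
    then have "C \<subset> UNIV" by blast
    then have "card C < n" using psubset_card_mono[of UNIV C] assms(2) by simp
    then show "card C \<le> n - 1" by simp
    have "n = card (C \<union> (\<Union>v\<in>C. nbhd v))"
    proof -
      have "C \<union> (\<Union>v\<in>C. nbhd v) = UNIV" using dom by (auto simp: nbhd_def)
      then show ?thesis using assms(2) by simp
    qed
    also have "\<dots> \<le> card C + card (\<Union>v\<in>C. nbhd v)" by (rule card_Un_le)
    also have "card (\<Union>v\<in>C. nbhd v) \<le> (\<Sum>v\<in>C. card (nbhd v))" by (rule card_UN_le) simp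
    also have "\<dots> \<le> (\<Sum>v\<in>C. dmax)" by (rule sum_mono) (rule card_nbhd_le_dmax)
    finally show "n \<le> card C * (dmax + 1)" by simp
  qed
  ultimately show "z \<in> {(q, q) | q :: int. q_min n \<le> q \<and> q \<le> int n - 2}" by blast
next
  fix z assume "z \<in> {(q, q) | q :: int. q_min n \<le> q \<and> q \<le> int n - 2}"
  then obtain q where z: "z = (q, q)" and q: "q_min n \<le> q" "q \<le> int n - 2" by blast
  obtain c where c: "1 \<le> c" "c \<le> n - 1" "q_min n \<ge> int c - 1"
    "\<And>d. q_min n \<le> int c + int d - 2 \<Longrightarrow> d \<ge> 1 \<and> n \<le> c * (d + 1)"
    using q_min_attained[OF assms(1)] by metis
  define d where "d = nat (q + 2 - int c)"
  have d: "q = int c + int d - 2" using c(3) q(1) by (simp add: d_def)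
  have "d \<ge> 1" "n \<le> c * (d + 1)" using c(4)[of d] q(1) d by auto
  moreover have "d \<le> n - c" using q(2) d by simp
  ultimately obtain E :: "'v set set" and C where E: "graph_connected E" "split_graph E"
    and C: "split_partition E C" "card C = c" "split_partition.dmax E C = d"
    using window_graph_exists[OF assms(2) c(1,2), of d] by blast
  interpret split_partition E C by (rule C(1))
  have "z = (regularity (cover_ideal E :: ('v, 'k) mpoly set),
           int (Polynomial.degree (h_polynomial (cover_ideal E :: ('v, 'k) mpoly set))))"
    unfolding z regularity_cover degree_h_polynomial_cover C(2,3) d ..
  then show "z \<in> {(regularity (cover_ideal E :: ('v, 'k) mpoly set),
           int (Polynomial.degree (h_polynomial (cover_ideal E :: ('v, 'k) mpoly set)))) | E :: 'v set set.
           simple_graph E \<and> graph_connected E \<and> split_graph E}"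
    using E simple by blast
qed

end
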